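(* Let $X\subseteq\mathbb C^n$ be an irreducible variety with $\mathrm{EDdeg}(X)>0$. Then the ED polynomial $f_u(\epsilon)\in\mathbb C[u,\epsilon]$ has degree exactly $2\cdot\mathrm{EDdeg}(X)$ in the variable $\epsilon$.
   Context: For $x,y\in\mathbb C^n$, $x\cdot y=\sum_{i=1}^n x_iy_i$ (complex bilinear), and $d_u(x)=(u-x)\cdot(u-x)$. For $x\in X_{\mathrm{reg}}$ (smooth locus), $N_xX$ is the span of gradients at $x$ of generators of the ideal of $X$. The ED correspondence $\mathcal E_X\subseteq\mathbb C^n\times\mathbb C^n$ is the Zariski closure of $\{(x,u):x\in X_{\mathrm{reg}},\ u-x\in N_xX\}$; $\mathrm{EDdeg}(X)$ is the cardinality of the fiber over generic $u$ of $(x,u)\mapsto u$ on $\mathcal E_X$ if this map is dominant, and $0$ otherwise. When $\mathrm{EDdeg}(X)>0$, the Zariski closure of the image of $\mathcal E_X\to\mathbb C^n\times\mathbb C$, $(x,u)\mapsto(u,d_u(x))$, is an irreducible hypersurface cut out by an irreducible polynomial $F_u(R)\in\mathbb C[u,R]$ (unique up to scalar); the ED polynomial is $f_u(\epsilon)=F_u(\epsilon^2)$. *)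

theory Defs
  imports Complex_Main "HOL-Library.Poly_Mapping" "HOL-Computational_Algebra.Factorial_Ring"
begin

text \<open>A polynomial in variables indexed by the (finite) type 'v is a finitely supported
  map from monomials (exponent vectors 'v =>0 nat) to complex coefficients.  Points of
  affine space C^'v are functions 'v => complex.\<close>

type_synonym 'v mpoly = "('v \<Rightarrow>\<^sub>0 nat) \<Rightarrow>\<^sub>0 complex"

definition mon_eval :: "('v::finite \<Rightarrow>\<^sub>0 nat) \<Rightarrow> ('v \<Rightarrow> complex) \<Rightarrow> complex" where
  "mon_eval m x = (\<Prod>i\<in>UNIV. x i ^ Poly_Mapping.lookup m i)"

definition mp_eval :: "'v::finite mpoly \<Rightarrow> ('v \<Rightarrow> complex) \<Rightarrow> complex" where
  "mp_eval p x = (\<Sum>m\<in>Poly_Mapping.keys p. Poly_Mapping.lookup p m * mon_eval m x)"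

definition mp_partial_eval :: "'v::finite mpoly \<Rightarrow> 'v \<Rightarrow> ('v \<Rightarrow> complex) \<Rightarrow> complex" where
  "mp_partial_eval p i x =
     (\<Sum>m\<in>Poly_Mapping.keys p. Poly_Mapping.lookup p m * of_nat (Poly_Mapping.lookup m i) *
        (\<Prod>j\<in>UNIV. x j ^ (Poly_Mapping.lookup m j - (if j = i then 1 else 0))))"

definition mp_grad :: "'v::finite mpoly \<Rightarrow> ('v \<Rightarrow> complex) \<Rightarrow> ('v \<Rightarrow> complex)" where
  "mp_grad p x = (\<lambda>i. mp_partial_eval p i x)"

definition zero_set :: "'v::finite mpoly set \<Rightarrow> ('v \<Rightarrow> complex) set" where
  "zero_set S = {x. \<forall>p\<in>S. mp_eval p x = 0}"

definition vanishing_ideal :: "('v::finite \<Rightarrow> complex) set \<Rightarrow> 'v mpoly set" where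
  "vanishing_ideal A = {p. \<forall>x\<in>A. mp_eval p x = 0}"

definition algebraic_set :: "('v::finite \<Rightarrow> complex) set \<Rightarrow> bool" where
  "algebraic_set X \<longleftrightarrow> (\<exists>S. X = zero_set S)"

definition zariski_closure :: "('v::finite \<Rightarrow> complex) set \<Rightarrow> ('v \<Rightarrow> complex) set" where
  "zariski_closure A = zero_set (vanishing_ideal A)"

definition irreducible_variety :: "('v::finite \<Rightarrow> complex) set \<Rightarrow> bool" where
  "irreducible_variety X \<longleftrightarrow> algebraic_set X \<and> X \<noteq> {} \<and>
     (\<forall>Y Z. algebraic_set Y \<and> algebraic_set Z \<and> X = Y \<union> Z \<longrightarrow> X = Y \<or> X = Z)"

definition variety_dim :: "('v::finite \<Rightarrow> complex) set \<Rightarrow> nat" where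
  "variety_dim X = Sup {k. \<exists>C::nat \<Rightarrow> ('v \<Rightarrow> complex) set.
       (\<forall>i\<le>k. irreducible_variety (C i) \<and> C i \<subseteq> X) \<and> (\<forall>i<k. C i \<subset> C (Suc i))}"

definition cspan :: "('v \<Rightarrow> complex) set \<Rightarrow> ('v \<Rightarrow> complex) set" where
  "cspan G = {v. \<exists>F c. finite F \<and> F \<subseteq> G \<and> v = (\<lambda>i. \<Sum>g\<in>F. c g * g i)}"

definition clin_indep :: "('v \<Rightarrow> complex) set \<Rightarrow> bool" where
  "clin_indep F \<longleftrightarrow> finite F \<and>
     (\<forall>c. (\<lambda>i. \<Sum>g\<in>F. c g * g i) = (\<lambda>i. 0) \<longrightarrow> (\<forall>g\<in>F. c g = 0))"

definition cdim :: "('v::finite \<Rightarrow> complex) set \<Rightarrow> nat" where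
  "cdim V = Max {card F | F. F \<subseteq> V \<and> clin_indep F}"

definition normal_space :: "('v::finite \<Rightarrow> complex) set \<Rightarrow> ('v \<Rightarrow> complex) \<Rightarrow> ('v \<Rightarrow> complex) set" where
  "normal_space X x = cspan {mp_grad p x | p. p \<in> vanishing_ideal X}"

text \<open>Smooth locus of an irreducible variety (Jacobian criterion, as in Hartshorne I.5):
  points where the Jacobian of the ideal has rank n - dim X.\<close>
definition smooth_locus :: "('v::finite \<Rightarrow> complex) set \<Rightarrow> ('v \<Rightarrow> complex) set" where
  "smooth_locus X = {x\<in>X. cdim (normal_space X x) = card (UNIV :: 'v set) - variety_dim X}"

definition pair_pt :: "('v \<Rightarrow> complex) \<Rightarrow> ('v \<Rightarrow> complex) \<Rightarrow> ('v + 'v \<Rightarrow> complex)" where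
  "pair_pt x u = case_sum x u"

definition sqdist :: "('v::finite \<Rightarrow> complex) \<Rightarrow> ('v \<Rightarrow> complex) \<Rightarrow> complex" where
  "sqdist u x = (\<Sum>i\<in>UNIV. (u i - x i) * (u i - x i))"

definition ED_corr :: "('v::finite \<Rightarrow> complex) set \<Rightarrow> (('v \<Rightarrow> complex) \<times> ('v \<Rightarrow> complex)) set" where
  "ED_corr X = {(x, u). pair_pt x u \<in> zariski_closure
       {pair_pt y w | y w. y \<in> smooth_locus X \<and> (\<lambda>i. w i - y i) \<in> normal_space X y}}"

definition ED_fiber :: "('v::finite \<Rightarrow> complex) set \<Rightarrow> ('v \<Rightarrow> complex) \<Rightarrow> ('v \<Rightarrow> complex) set" where
  "ED_fiber X u = {x. (x, u) \<in> ED_corr X}"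

definition ED_dominant :: "('v::finite \<Rightarrow> complex) set \<Rightarrow> bool" where
  "ED_dominant X \<longleftrightarrow> zariski_closure (snd ` ED_corr X) = UNIV"

definition generic_fiber_card :: "('v::finite \<Rightarrow> complex) set \<Rightarrow> nat \<Rightarrow> bool" where
  "generic_fiber_card X d \<longleftrightarrow> (\<exists>Z. algebraic_set Z \<and> Z \<noteq> UNIV \<and>
      (\<forall>u. u \<notin> Z \<longrightarrow> finite (ED_fiber X u) \<and> card (ED_fiber X u) = d))"

definition EDdeg :: "('v::finite \<Rightarrow> complex) set \<Rightarrow> nat" where
  "EDdeg X = (if ED_dominant X then (THE d. generic_fiber_card X d) else 0)"

text \<open>Polynomials in C[u,R]: variables 'v option, with None standing for R and Some i
  for u_i.  A point (u, r) of C^n x C is encoded as below.\<close>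
definition uR_pt :: "('v \<Rightarrow> complex) \<Rightarrow> complex \<Rightarrow> ('v option \<Rightarrow> complex)" where
  "uR_pt u r = (\<lambda>v. case v of None \<Rightarrow> r | Some i \<Rightarrow> u i)"

definition ED_image :: "('v::finite \<Rightarrow> complex) set \<Rightarrow> ('v option \<Rightarrow> complex) set" where
  "ED_image X = {uR_pt u (sqdist u x) | x u. (x, u) \<in> ED_corr X}"

definition is_ED_poly_R :: "('v::finite \<Rightarrow> complex) set \<Rightarrow> 'v option mpoly \<Rightarrow> bool" where
  "is_ED_poly_R X F \<longleftrightarrow> irreducible F \<and> zariski_closure (ED_image X) = zero_set {F}"

text \<open>Substitution R := epsilon^2 (epsilon is again the variable None).\<close>
definition double_R :: "('v option \<Rightarrow>\<^sub>0 nat) \<Rightarrow> ('v option \<Rightarrow>\<^sub>0 nat)" where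
  "double_R m = m + Poly_Mapping.single None (Poly_Mapping.lookup m None)"

definition ED_poly_eps :: "'v option mpoly \<Rightarrow> 'v option mpoly" where
  "ED_poly_eps F = (\<Sum>m\<in>Poly_Mapping.keys F. Poly_Mapping.single (double_R m) (Poly_Mapping.lookup F m))"

definition degree_in :: "'w \<Rightarrow> 'w mpoly \<Rightarrow> nat" where
  "degree_in v p = Max (insert 0 ((\<lambda>m. Poly_Mapping.lookup m v) ` Poly_Mapping.keys p))"

end

theory Submission
  imports Defs "HOL-Computational_Algebra.Fundamental_Theorem_Algebra"
begin

text \<open>Write \<open>R = d\<^sub>u(x)\<close>. On the ED correspondence \<open>u - x\<close> is normal to \<open>X\<close>, so a derivation \<open>D\<close> of its coordinate
  ring satisfies \<open>D R = 2 (u - x) \<cdot> D u\<close>. Dominance provides such derivations with prescribed \<open>D u\<close>,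
  and applying them to \<open>F(u, R) = 0\<close> gives \<open>\<partial>F/\<partial>u\<^sub>i + 2 (u\<^sub>i - x\<^sub>i) \<partial>F/\<partial>R = 0\<close>. For generic \<open>u\<close> the roots
  of \<open>F\<^sub>u\<close> are simple because \<open>F\<close> is irreducible, hence \<open>x\<close> is a rational function of \<open>(u, R)\<close> and \<open>x \<mapsto> R\<close>
  is a bijection from the fiber over \<open>u\<close> onto the roots of \<open>F\<^sub>u\<close>. The derivations are built modulo a prime ideal;
  Noetherian induction on vanishing ideals of subsets of the correspondence reduces the gradient
  equation to that case.\<close>

section \<open>Subrings and ideals as sets\<close>

text \<open>The zero set of F is only the closure of the image, so a root r over a given u need not
  come from a critical point a priori. The explicit inverse x_i = u_i + (dF/du_i) / (2 dF/dR)
  removes this obstacle. It is defined at every point of F = 0 with dF/dR nonzero, and the claims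
  that it lands in the correspondence and has squared distance r become polynomial identities once
  denominators are cleared; they hold on the image, hence on its closure.

  The derivations act on the full polynomial ring and are only required to map the ideal into
  itself, which avoids quotient rings and function fields. Simplicity of the roots needs irreducible
  polynomials to be prime. This is proved along with Hilbert's basis theorem by adjoining one
  variable at a time. Since the number of variables is fixed by a type, the intermediate rings are
  subsets of one ring type: the functions that involve only the variables of a finite set. Hence
  rings, ideals and divisibility are all relative to carrier sets.\<close>

definition is_subring :: "'a::comm_ring_1 set \<Rightarrow> bool" where
  "is_subring B \<longleftrightarrow> 1 \<in> B \<and> (\<forall>a\<in>B. \<forall>b\<in>B. a - b \<in> B \<and> a * b \<in> B)"

lemma is_subringD:
  assumes "is_subring B"
  shows is_subring_one: "1 \<in> B" and is_subring_zero: "0 \<in> B"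
    and is_subring_diff: "a \<in> B \<Longrightarrow> b \<in> B \<Longrightarrow> a - b \<in> B"
    and is_subring_uminus: "a \<in> B \<Longrightarrow> - a \<in> B"
    and is_subring_add: "a \<in> B \<Longrightarrow> b \<in> B \<Longrightarrow> a + b \<in> B"
    and is_subring_mult: "a \<in> B \<Longrightarrow> b \<in> B \<Longrightarrow> a * b \<in> B"
proof -
  have d: "a - b \<in> B" if "a \<in> B" "b \<in> B" for a b using that assms by (auto simp: is_subring_def)
  show 1: "1 \<in> B" and "a \<in> B \<Longrightarrow> b \<in> B \<Longrightarrow> a * b \<in> B"
    using assms by (auto simp: is_subring_def)
  show 0: "0 \<in> B" using d[OF 1 1] by simp
  show "a \<in> B \<Longrightarrow> - a \<in> B" using d[OF 0, of a] by simp
  show "a \<in> B \<Longrightarrow> b \<in> B \<Longrightarrow> a + b \<in> B" using d[OF _ d[OF 0], of a b] by simp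
  show "a \<in> B \<Longrightarrow> b \<in> B \<Longrightarrow> a - b \<in> B" by (rule d)
qed

lemma is_subring_sum:
  assumes "is_subring B" "\<And>i. i \<in> I \<Longrightarrow> f i \<in> B"
  shows "sum f I \<in> B"
  using assms(2) by (induction I rule: infinite_finite_induct)
    (auto intro: is_subring_zero is_subring_add assms(1))

lemma is_subring_power: "is_subring B \<Longrightarrow> a \<in> B \<Longrightarrow> a ^ n \<in> B"
  by (induction n) (auto intro: is_subring_one is_subring_mult)

definition is_ideal :: "'a::comm_ring_1 set \<Rightarrow> 'a set \<Rightarrow> bool" where
  "is_ideal R I \<longleftrightarrow> 0 \<in> I \<and> I \<subseteq> R \<and> (\<forall>a\<in>I. \<forall>b\<in>I. a + b \<in> I) \<and> (\<forall>r\<in>R. \<forall>a\<in>I. r * a \<in> I)"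

lemma is_idealD:
  assumes "is_ideal R I"
  shows is_ideal_zero: "0 \<in> I" and is_ideal_subset: "a \<in> I \<Longrightarrow> a \<in> R"
    and is_ideal_add: "a \<in> I \<Longrightarrow> b \<in> I \<Longrightarrow> a + b \<in> I"
    and is_ideal_mult: "r \<in> R \<Longrightarrow> a \<in> I \<Longrightarrow> r * a \<in> I"
  using assms by (auto simp: is_ideal_def)

lemma is_ideal_uminus:
  assumes "is_subring R" "is_ideal R I" "a \<in> I"
  shows "- a \<in> I"
  using is_ideal_mult[OF assms(2) is_subring_uminus[OF assms(1) is_subring_one[OF assms(1)]] assms(3)]
  by simp

lemma is_ideal_diff:
  assumes "is_subring R" "is_ideal R I" "a \<in> I" "b \<in> I"
  shows "a - b \<in> I"
  using is_ideal_add[OF assms(2,3) is_ideal_uminus[OF assms(1,2,4)]] by simp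

text \<open>Combinations are built one term at a time, so that membership is used by induction over
  the terms instead of through finite sums with families of coefficients.\<close>

inductive_set ideal_gen :: "'a::comm_ring_1 set \<Rightarrow> 'a set \<Rightarrow> 'a set" for R G where
  zero: "0 \<in> ideal_gen R G"
| step: "a \<in> ideal_gen R G \<Longrightarrow> r \<in> R \<Longrightarrow> g \<in> G \<Longrightarrow> r * g + a \<in> ideal_gen R G"

lemma ideal_gen_add:
  "a \<in> ideal_gen R G \<Longrightarrow> b \<in> ideal_gen R G \<Longrightarrow> a + b \<in> ideal_gen R G"
  by (induction rule: ideal_gen.induct) (auto simp: add.assoc intro: ideal_gen.intros)

lemma ideal_gen_mult:
  assumes "is_subring R" "r \<in> R"
  shows "a \<in> ideal_gen R G \<Longrightarrow> r * a \<in> ideal_gen R G"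
proof (induction rule: ideal_gen.induct)
  case (step a s g)
  have "r * (s * g + a) = (r * s) * g + r * a" by (simp add: algebra_simps)
  then show ?case using step is_subring_mult[OF assms(1,2)] by (simp add: ideal_gen.step)
qed (auto intro: ideal_gen.zero)

lemma ideal_gen_superset:
  assumes "is_subring R" "g \<in> G" shows "g \<in> ideal_gen R G"
  using ideal_gen.step[OF ideal_gen.zero is_subring_one[OF assms(1)] assms(2)] by simp

lemma is_ideal_ideal_gen:
  assumes "is_subring R" "G \<subseteq> R" shows "is_ideal R (ideal_gen R G)"
proof -
  have "a \<in> ideal_gen R G \<Longrightarrow> a \<in> R" for a
    by (induction rule: ideal_gen.induct)
      (use assms in \<open>auto intro: is_subring_zero is_subring_add is_subring_mult\<close>)
  then show ?thesis
    using assms by (auto simp: is_ideal_def ideal_gen.zero ideal_gen_add ideal_gen_mult)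
qed

lemma ideal_gen_least:
  assumes "is_ideal R I" "G \<subseteq> I" shows "ideal_gen R G \<subseteq> I"
proof
  show "a \<in> ideal_gen R G \<Longrightarrow> a \<in> I" for a
    by (induction rule: ideal_gen.induct)
      (use assms in \<open>auto intro: is_ideal_zero is_ideal_add is_ideal_mult\<close>)
qed

lemma ideal_gen_mono: "G \<subseteq> H \<Longrightarrow> ideal_gen R G \<subseteq> ideal_gen R H"
proof
  show "G \<subseteq> H \<Longrightarrow> a \<in> ideal_gen R G \<Longrightarrow> a \<in> ideal_gen R H" for a
    by (rotate_tac, induction rule: ideal_gen.induct) (auto intro: ideal_gen.intros)
qed

section \<open>Noetherian carriers and the ascending chain condition\<close>

definition noetherian :: "'a::comm_ring_1 set \<Rightarrow> bool" where
  "noetherian R \<longleftrightarrow> (\<forall>I. is_ideal R I \<longrightarrow> (\<exists>G. finite G \<and> G \<subseteq> I \<and> I \<subseteq> ideal_gen R G))"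

lemma finite_subset_UN_mono:
  fixes J :: "nat \<Rightarrow> 'a set"
  assumes "finite G" "G \<subseteq> (\<Union>n. J n)" "\<And>m n. m \<le> n \<Longrightarrow> J m \<subseteq> J n"
  shows "\<exists>N. G \<subseteq> J N"
  using assms(1,2)
proof (induction G)
  case (insert g G)
  then obtain N M where "G \<subseteq> J N" "g \<in> J M" by auto
  then have "insert g G \<subseteq> J (max M N)"
    using assms(3)[of N "max M N"] assms(3)[of M "max M N"] by auto
  then show ?case ..
qed auto

text \<open>The union of an ascending chain is an ideal, and its finitely many generators lie in one
  member, where the chain must stop. Larger ideals come lower in this relation: the induction
  hypothesis covers all strictly larger ideals.\<close>

lemma noetherian_wf:
  assumes "is_subring R" "noetherian R"
  shows "wf {(J, I). is_ideal R I \<and> is_ideal R J \<and> I \<subset> J}"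
  unfolding wf_iff_no_infinite_down_chain
proof (rule notI, elim exE)
  fix f assume "\<forall>i. (f (Suc i), f i) \<in> {(J, I). is_ideal R I \<and> is_ideal R J \<and> I \<subset> J}"
  then have id: "is_ideal R (f i)" and st: "f i \<subset> f (Suc i)" for i by auto
  have mono: "m \<le> n \<Longrightarrow> f m \<subseteq> f n" for m n
    using lift_Suc_mono_le[of f m n] st by auto
  have "is_ideal R (\<Union>i. f i)"
    unfolding is_ideal_def
  proof (intro conjI ballI)
    fix a b assume "a \<in> (\<Union>i. f i)" "b \<in> (\<Union>i. f i)"
    then obtain i j where "a \<in> f i" "b \<in> f j" by auto
    then have "a \<in> f (max i j)" "b \<in> f (max i j)"
      using mono[of i "max i j"] mono[of j "max i j"] by auto
    then show "a + b \<in> (\<Union>i. f i)" using is_ideal_add[OF id] by blast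
  next
    show "0 \<in> (\<Union>i. f i)" using is_ideal_zero[OF id] by simp
    show "(\<Union>i. f i) \<subseteq> R" using is_ideal_subset[OF id] by auto
    show "r * a \<in> (\<Union>i. f i)" if "r \<in> R" "a \<in> (\<Union>i. f i)" for r a
      using that is_ideal_mult[OF id] by auto
  qed
  then obtain G where G: "finite G" "G \<subseteq> (\<Union>i. f i)" "(\<Union>i. f i) \<subseteq> ideal_gen R G"
    using assms(2) unfolding noetherian_def by blast
  obtain N where "G \<subseteq> f N" using finite_subset_UN_mono[OF G(1,2) mono] by auto
  then have "(\<Union>i. f i) \<subseteq> f N" using ideal_gen_least[OF id] G(3) by blast
  then show False using st[of N] by auto
qed

lemma noetherian_field:
  assumes "is_subring R" "\<And>a. a \<in> R \<Longrightarrow> a \<noteq> 0 \<Longrightarrow> \<exists>b\<in>R. b * a = 1"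
  shows "noetherian R"
  unfolding noetherian_def
proof (intro allI impI)
  fix I assume I: "is_ideal R I"
  show "\<exists>G. finite G \<and> G \<subseteq> I \<and> I \<subseteq> ideal_gen R G"
  proof (cases "I \<subseteq> {0}")
    case True
    then show ?thesis by (intro exI[of _ "{}"]) (auto intro: ideal_gen.zero)
  next
    case False
    then obtain a b where a: "a \<in> I" "a \<noteq> 0" and b: "b \<in> R" "b * a = 1"
      using assms(2) is_ideal_subset[OF I] by blast
    have "x \<in> ideal_gen R {a}" if "x \<in> I" for x
    proof -
      have "x = (x * b) * a + 0" using b by (simp add: mult.assoc)
      then show ?thesis using ideal_gen.step[OF ideal_gen.zero, of "x * b" R a "{a}"]
          is_subring_mult[OF assms(1) is_ideal_subset[OF I that] b(1)] by simp
    qed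
    then show ?thesis using a by (intro exI[of _ "{a}"]) auto
  qed
qed

section \<open>Polynomials over a subring\<close>

definition polys_over :: "'a::comm_ring_1 set \<Rightarrow> 'a poly set" where
  "polys_over B = {q. \<forall>i. coeff q i \<in> B}"

lemma polys_overI: "(\<And>i. coeff q i \<in> B) \<Longrightarrow> q \<in> polys_over B"
  and polys_overD: "q \<in> polys_over B \<Longrightarrow> coeff q i \<in> B"
  by (auto simp: polys_over_def)

lemma is_subring_polys_over:
  assumes "is_subring B" shows "is_subring (polys_over B)"
  unfolding is_subring_def polys_over_def
  using assms by (auto simp: coeff_mult coeff_1 intro!: is_subring_sum is_subring_mult
      is_subring_one is_subring_zero is_subring_diff)

lemma monom_in_polys_over: "is_subring B \<Longrightarrow> b \<in> B \<Longrightarrow> monom b n \<in> polys_over B"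
  by (auto intro!: polys_overI is_subring_zero)

lemma const_in_polys_over: "is_subring B \<Longrightarrow> b \<in> B \<Longrightarrow> [:b:] \<in> polys_over B"
  by (metis monom_0 monom_in_polys_over)

lemma smult_in_polys_over: "is_subring B \<Longrightarrow> b \<in> B \<Longrightarrow> q \<in> polys_over B \<Longrightarrow> smult b q \<in> polys_over B"
  by (auto intro!: polys_overI is_subring_mult dest: polys_overD)

lemma pderiv_in_polys_over:
  assumes "is_subring B" "q \<in> polys_over B" shows "pderiv q \<in> polys_over B"
proof (rule polys_overI)
  have "of_nat n \<in> B" for n
    by (induction n) (auto intro: assms(1) is_subring_zero is_subring_one is_subring_add)
  then show "coeff (pderiv q) i \<in> B" for i
    using assms by (metis coeff_pderiv is_subring_mult polys_overD)
qed

text \<open>Hilbert's basis theorem: in an ideal that is not finitely generated pick successive elements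
  of minimal degree outside the ideal generated so far; a relation between their leading
  coefficients lowers the degree.\<close>

theorem noetherian_polys_over:
  fixes B :: "'a::comm_ring_1 set"
  assumes B: "is_subring B" and N: "noetherian B"
  shows "noetherian (polys_over B)"
  unfolding noetherian_def
proof (intro allI impI, rule ccontr)
  let ?R = "polys_over B"
  note R = is_subring_polys_over[OF B]
  fix I assume I: "is_ideal ?R I"
  assume "\<nexists>G. finite G \<and> G \<subseteq> I \<and> I \<subseteq> ideal_gen ?R G"
  then have ex: "\<exists>h. h \<in> I - ideal_gen ?R G" if "finite G" "G \<subseteq> I" for G using that by blast
  define pick where "pick G = (ARG_MIN degree h. h \<in> I - ideal_gen ?R G)" for G
  have pick: "pick G \<in> I - ideal_gen ?R G" "\<And>h. h \<in> I - ideal_gen ?R G \<Longrightarrow> degree (pick G) \<le> degree h"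
    if "finite G" "G \<subseteq> I" for G
  proof -
    obtain h where h: "h \<in> I - ideal_gen ?R G" using ex \<open>finite G\<close> \<open>G \<subseteq> I\<close> by blast
    show "pick G \<in> I - ideal_gen ?R G" "\<And>h. h \<in> I - ideal_gen ?R G \<Longrightarrow> degree (pick G) \<le> degree h"
      using arg_min_nat_lemma[of "\<lambda>h. h \<in> I - ideal_gen ?R G", OF h, of degree]
      unfolding pick_def by simp_all
  qed
  define Gs where "Gs = rec_nat {} (\<lambda>_ G. insert (pick G) G)"
  define g where "g k = pick (Gs k)" for k
  have Gs0: "Gs 0 = {}" and GsS: "Gs (Suc k) = insert (g k) (Gs k)" for k
    by (simp_all add: Gs_def g_def)
  have Gs_fin: "finite (Gs k) \<and> Gs k \<subseteq> I" for k
    using pick(1) by (induction k) (auto simp: Gs0 GsS g_def)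
  have Gs_eq: "Gs k = g ` {..<k}" for k
    by (induction k) (auto simp: Gs0 GsS lessThan_Suc)
  have gI: "g k \<in> I" and gn: "g k \<notin> ideal_gen ?R (Gs k)"
    and gmin: "h \<in> I \<Longrightarrow> h \<notin> ideal_gen ?R (Gs k) \<Longrightarrow> degree (g k) \<le> degree h" for k h
    using pick[of "Gs k"] Gs_fin[of k] by (auto simp: g_def)
  have gR: "g k \<in> ?R" for k using gI is_ideal_subset[OF I] by blast
  have "degree (g k) \<le> degree (g (Suc k))" for k
    using gmin[OF gI, of "Suc k" k] gn[of "Suc k"] ideal_gen_mono[of "Gs k" "Gs (Suc k)" ?R]
    by (auto simp: GsS)
  then have degmono: "i \<le> k \<Longrightarrow> degree (g i) \<le> degree (g k)" for i k
    by (rule lift_Suc_mono_le[of "\<lambda>k. degree (g k)"])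
  define a where "a k = lead_coeff (g k)" for k
  have aB: "range a \<subseteq> B" using gR by (auto simp: a_def intro: polys_overD)
  obtain H where H: "finite H" "H \<subseteq> ideal_gen B (range a)" "ideal_gen B (range a) \<subseteq> ideal_gen B H"
    using N is_ideal_ideal_gen[OF B aB] unfolding noetherian_def by blast
  \<comment> \<open>Each combination involves finitely many leading coefficients. Hence the finite
    basis \<open>H\<close>, and with it \<open>a n\<close>, is generated by the coefficients with
    index below some \<open>n\<close>.\<close>
  have "ideal_gen B (range a) \<subseteq> (\<Union>n. ideal_gen B (a ` {..<n}))"
  proof
    fix x show "x \<in> ideal_gen B (range a) \<Longrightarrow> x \<in> (\<Union>n. ideal_gen B (a ` {..<n}))"
    proof (induction rule: ideal_gen.induct)
      case (step x r y)
      then obtain n k where n: "x \<in> ideal_gen B (a ` {..<n})" "y = a k" by auto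
      have "x \<in> ideal_gen B (a ` {..<max n (Suc k)})"
        using n(1) ideal_gen_mono[OF image_mono, of "{..<n}" "{..<max n (Suc k)}" B a] by auto
      moreover have "y \<in> a ` {..<max n (Suc k)}" using n(2) by auto
      ultimately have "r * y + x \<in> ideal_gen B (a ` {..<max n (Suc k)})"
        using step(2) by (intro ideal_gen.step)
      then show ?case by (rule UN_I[OF UNIV_I])
    qed (auto intro: ideal_gen.zero)
  qed
  then have "\<exists>n. H \<subseteq> ideal_gen B (a ` {..<n})"
    by (intro finite_subset_UN_mono[OF H(1)] ideal_gen_mono image_mono) (use H(2) in auto)
  then obtain n where n: "H \<subseteq> ideal_gen B (a ` {..<n})" ..
  have "a ` {..<n} \<subseteq> B" using aB by auto
  then have "ideal_gen B H \<subseteq> ideal_gen B (a ` {..<n})"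
    using ideal_gen_least[OF is_ideal_ideal_gen[OF B] n] by blast
  then have an: "a n \<in> ideal_gen B (a ` {..<n})"
    using H(3) ideal_gen_superset[OF B, of "a n" "range a"] by auto
  let ?d = "degree (g n)"
  \<comment> \<open>The combination of leading coefficients is lifted to one of the
    \<open>g k\<close>, each shifted to degree \<open>?d\<close> by a monomial. The shift exists
    because the degrees of the \<open>g k\<close> never decrease.\<close>
  have "\<exists>q \<in> ideal_gen ?R (Gs n). degree q \<le> ?d \<and> coeff q ?d = b"
    if "b \<in> ideal_gen B (a ` {..<n})" for b
    using that
  proof (induction rule: ideal_gen.induct)
    case zero
    show ?case by (intro bexI[of _ 0]) (auto intro: ideal_gen.zero)
  next
    case (step b r y)
    then obtain q k where q: "q \<in> ideal_gen ?R (Gs n)" "degree q \<le> ?d" "coeff q ?d = b"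
      and k: "k < n" "y = a k" by auto
    let ?m = "?d - degree (g k)"
    have dk: "degree (g k) \<le> ?d" using degmono k by simp
    have "degree (monom r ?m * g k) \<le> ?d"
      using degree_mult_le[of "monom r ?m" "g k"] degree_monom_le[of r ?m] dk by linarith
    moreover have "coeff (monom r ?m * g k) ?d = r * y"
      using dk k by (simp add: coeff_monom_mult a_def)
    moreover have "monom r ?m * g k + q \<in> ideal_gen ?R (Gs n)"
      using q(1) monom_in_polys_over[OF B step(2)] k by (intro ideal_gen.step) (auto simp: Gs_eq)
    ultimately show ?case using q
      by (intro bexI[of _ "monom r ?m * g k + q"]) (auto intro: degree_add_le)
  qed
  from this[OF an] obtain q where q: "q \<in> ideal_gen ?R (Gs n)" "degree q \<le> ?d" "coeff q ?d = a n"
    by auto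
  have qI: "q \<in> I" using q(1) ideal_gen_least[OF I] Gs_fin by blast
  have hn: "g n - q \<notin> ideal_gen ?R (Gs n)"
    using gn[of n] ideal_gen_add[OF _ q(1), of "g n - q"] by auto
  have "degree (g n) \<le> degree (g n - q)"
    using gmin[OF is_ideal_diff[OF R I gI qI] hn] .
  moreover have "degree (g n - q) \<le> degree (g n)" using q(2) by (simp add: degree_diff_le)
  ultimately have "lead_coeff (g n - q) = 0" using q(3) by (simp add: a_def)
  then have "g n - q = 0" by (simp only: leading_coeff_0_iff)
  then show False using hn by (simp add: ideal_gen.zero)
qed

section \<open>Irreducible elements are prime\<close>

definition dvd_in :: "'a::comm_ring_1 set \<Rightarrow> 'a \<Rightarrow> 'a \<Rightarrow> bool" where
  "dvd_in R a b \<longleftrightarrow> (\<exists>c\<in>R. b = a * c)"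

definition irreducible_in :: "'a::comm_ring_1 set \<Rightarrow> 'a \<Rightarrow> bool" where
  "irreducible_in R p \<longleftrightarrow> p \<in> R \<and> p \<noteq> 0 \<and> \<not> dvd_in R p 1 \<and>
     (\<forall>a\<in>R. \<forall>b\<in>R. p = a * b \<longrightarrow> dvd_in R a 1 \<or> dvd_in R b 1)"

text \<open>Units satisfy this condition as well, which settles the unit case of
  \<open>primal_in_polys_over_const\<close>.\<close>

definition prime_in :: "'a::comm_ring_1 set \<Rightarrow> 'a \<Rightarrow> bool" where
  "prime_in R p \<longleftrightarrow> (\<forall>a\<in>R. \<forall>b\<in>R. dvd_in R p (a * b) \<longrightarrow> dvd_in R p a \<or> dvd_in R p b)"

text \<open>In a noetherian domain, where factorizations into irreducibles exist, this is unique
  factorization.\<close>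

definition irreducibles_prime :: "'a::comm_ring_1 set \<Rightarrow> bool" where
  "irreducibles_prime R \<longleftrightarrow> (\<forall>p. irreducible_in R p \<longrightarrow> prime_in R p)"

text \<open>Cohn's primal elements. In contrast to primality this property passes to products, so it
  can hold for every nonzero constant and stands in for contents and gcds.\<close>

definition primal_in :: "'a::comm_ring_1 set \<Rightarrow> 'a \<Rightarrow> bool" where
  "primal_in R c \<longleftrightarrow> (\<forall>g\<in>R. \<forall>h\<in>R. dvd_in R c (g * h) \<longrightarrow>
     (\<exists>c1\<in>R. \<exists>c2\<in>R. c = c1 * c2 \<and> dvd_in R c1 g \<and> dvd_in R c2 h))"

lemma dvd_in_trans:
  assumes "is_subring R" "dvd_in R a b" "dvd_in R b c" shows "dvd_in R a c"
  using assms is_subring_mult[OF assms(1)] unfolding dvd_in_def by (metis mult.assoc)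

lemma dvd_in_mult: "is_subring R \<Longrightarrow> dvd_in R a b \<Longrightarrow> c \<in> R \<Longrightarrow> dvd_in R a (b * c)"
  unfolding dvd_in_def by (metis is_subring_mult mult.assoc)

lemma dvd_in_add: "is_subring R \<Longrightarrow> dvd_in R a b \<Longrightarrow> dvd_in R a c \<Longrightarrow> dvd_in R a (b + c)"
  unfolding dvd_in_def by (metis is_subring_add distrib_left)

lemma dvd_in_diff: "is_subring R \<Longrightarrow> dvd_in R a b \<Longrightarrow> dvd_in R a c \<Longrightarrow> dvd_in R a (b - c)"
  unfolding dvd_in_def by (metis is_subring_diff right_diff_distrib)

lemma dvd_in_zero: "is_subring R \<Longrightarrow> dvd_in R a 0"
  unfolding dvd_in_def by (metis is_subring_zero mult_zero_right)

text \<open>Split \<open>a\<close> along \<open>g\<close> and \<open>h\<close>, cancel it, then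
  split \<open>b\<close> along the two cofactors.\<close>

lemma primal_in_mult:
  fixes R :: "'a::idom set"
  assumes R: "is_subring R" and a: "primal_in R a" "a \<in> R" "a \<noteq> 0" and b: "primal_in R b" "b \<in> R"
  shows "primal_in R (a * b)"
  unfolding primal_in_def
proof (intro ballI impI)
  fix g h assume gh: "g \<in> R" "h \<in> R" and "dvd_in R (a * b) (g * h)"
  then obtain k where k: "k \<in> R" "g * h = a * b * k" unfolding dvd_in_def by blast
  then have "dvd_in R a (g * h)"
    using is_subring_mult[OF R] b(2) unfolding dvd_in_def by (metis mult.assoc)
  then obtain a1 a2 g' h' where a12: "a1 \<in> R" "a2 \<in> R" "a = a1 * a2"
    and g': "g' \<in> R" "g = a1 * g'" and h': "h' \<in> R" "h = a2 * h'"
    using a(1) gh unfolding primal_in_def dvd_in_def by blast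
  have "a * (g' * h') = a * (b * k)"
    using k(2) unfolding a12(3) g'(2) h'(2) by (simp add: mult_ac)
  then have "g' * h' = b * k" using a(3) by simp
  then have "dvd_in R b (g' * h')" using k(1) unfolding dvd_in_def by blast
  then obtain b1 b2 g'' h'' where b12: "b1 \<in> R" "b2 \<in> R" "b = b1 * b2"
    and g'': "g'' \<in> R" "g' = b1 * g''" and h'': "h'' \<in> R" "h' = b2 * h''"
    using b(1) g' h' unfolding primal_in_def dvd_in_def by blast
  show "\<exists>c1\<in>R. \<exists>c2\<in>R. a * b = c1 * c2 \<and> dvd_in R c1 g \<and> dvd_in R c2 h"
  proof (intro bexI conjI)
    show "a * b = (a1 * b1) * (a2 * b2)" unfolding a12 b12 by (simp add: mult_ac)
    show "dvd_in R (a1 * b1) g" using g'' unfolding g' dvd_in_def by (auto simp: mult_ac)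
    show "dvd_in R (a2 * b2) h" using h'' unfolding h' dvd_in_def by (auto simp: mult_ac)
  qed (use a12 b12 R in \<open>auto intro: is_subring_mult\<close>)
qed

text \<open>If \<open>c = a * b\<close> with neither factor a unit, the principal ideals of
  \<open>a\<close> and \<open>b\<close> are strictly larger than that of \<open>c\<close>, so the
  ascending chain condition justifies the induction.\<close>

lemma noetherian_factorization_induct:
  fixes R :: "'a::idom set"
  assumes R: "is_subring R" and N: "noetherian R"
    and unit: "\<And>c. c \<in> R \<Longrightarrow> dvd_in R c 1 \<Longrightarrow> P c"
    and irred: "\<And>c. irreducible_in R c \<Longrightarrow> P c"
    and mult: "\<And>a b. a \<in> R \<Longrightarrow> b \<in> R \<Longrightarrow> a \<noteq> 0 \<Longrightarrow> b \<noteq> 0 \<Longrightarrow> P a \<Longrightarrow> P b \<Longrightarrow> P (a * b)"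
    and c: "c \<in> R" "c \<noteq> 0"
  shows "P c"
proof -
  define mult_of where "mult_of c = {x * c | x. x \<in> R}" for c
  have ideal: "is_ideal R (mult_of c)" if "c \<in> R" for c
    unfolding is_ideal_def mult_of_def
  proof (intro conjI ballI)
    show "0 \<in> {x * c |x. x \<in> R}" using is_subring_zero[OF R] by (auto intro!: exI[of _ 0])
    show "{x * c |x. x \<in> R} \<subseteq> R" using that is_subring_mult[OF R] by auto
    show "a + b \<in> {x * c |x. x \<in> R}" if "a \<in> {x * c |x. x \<in> R}" "b \<in> {x * c |x. x \<in> R}" for a b
      using that is_subring_add[OF R] by (auto simp: distrib_right[symmetric])
    show "r * a \<in> {x * c |x. x \<in> R}" if "r \<in> R" "a \<in> {x * c |x. x \<in> R}" for r a
      using that is_subring_mult[OF R] by (auto simp: mult.assoc[symmetric])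
  qed
  have less: "mult_of (a * b) \<subset> mult_of a" if "a \<in> R" "b \<in> R" "a \<noteq> 0" "\<not> dvd_in R b 1" for a b
  proof
    show "mult_of (a * b) \<subseteq> mult_of a"
      unfolding mult_of_def using is_subring_mult[OF R that(2)]
      by (auto, metis is_subring_mult[OF R] mult.assoc mult.commute that(2))
    show "mult_of (a * b) \<noteq> mult_of a"
    proof
      assume "mult_of (a * b) = mult_of a"
      moreover have "a \<in> mult_of a" using is_subring_one[OF R] by (auto simp: mult_of_def intro!: exI[of _ 1])
      ultimately have "a \<in> mult_of (a * b)" by simp
      then obtain x where x: "x \<in> R" "a = x * (a * b)" unfolding mult_of_def by blast
      then have "a * (b * x) = a * 1" by (simp add: mult_ac)
      then have "b * x = 1" using that(3) by (metis mult_left_cancel)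
      then show False using that(4) x(1) unfolding dvd_in_def by metis
    qed
  qed
  have "\<forall>c. I = mult_of c \<longrightarrow> c \<in> R \<longrightarrow> c \<noteq> 0 \<longrightarrow> P c" for I
  proof (induction I rule: wf_induct_rule[OF noetherian_wf[OF R N]])
    case (1 I)
    show ?case
    proof (intro allI impI)
      fix c assume c: "I = mult_of c" "c \<in> R" "c \<noteq> 0"
      show "P c"
      proof (cases "dvd_in R c 1 \<or> irreducible_in R c")
        case True
        then show ?thesis using unit irred c by blast
      next
        case False
        then obtain a b where ab: "a \<in> R" "b \<in> R" "c = a * b" "\<not> dvd_in R a 1" "\<not> dvd_in R b 1"
          using c unfolding irreducible_in_def by blast
        then have nz: "a \<noteq> 0" "b \<noteq> 0" using c by auto
        have "P a" using 1[rule_format, of "mult_of a" a] less[OF ab(1,2) nz(1) ab(5)] ideal ab nz c by auto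
        moreover have "P b" using 1[rule_format, of "mult_of b" b] less[OF ab(2,1) nz(2) ab(4)] ideal ab nz c
          by (auto simp: mult.commute)
        ultimately show ?thesis using mult ab nz by simp
      qed
    qed
  qed
  then show ?thesis using c by blast
qed

section \<open>Gauss's lemma: constants in a polynomial ring\<close>

lemma const_dvd_in_polys_over_iff:
  fixes B :: "'a::comm_ring_1 set"
  assumes B: "is_subring B"
  shows "dvd_in (polys_over B) [:p:] q \<longleftrightarrow> (\<forall>i. dvd_in B p (coeff q i))"
proof
  assume "dvd_in (polys_over B) [:p:] q"
  then show "\<forall>i. dvd_in B p (coeff q i)" unfolding dvd_in_def by (auto dest: polys_overD)
next
  assume *: "\<forall>i. dvd_in B p (coeff q i)"
  \<comment> \<open>Quotients are set to 0 where the coefficient vanishes. An arbitrary choice could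
    be nonzero infinitely often, for instance when \<open>p = 0\<close>, and would not be a
    polynomial.\<close>
  define c where "c i = (if coeff q i = 0 then 0 else SOME c. c \<in> B \<and> coeff q i = p * c)" for i
  have c: "c i \<in> B \<and> coeff q i = p * c i" for i
  proof (cases "coeff q i = 0")
    case False
    have "\<exists>c. c \<in> B \<and> coeff q i = p * c" using * unfolding dvd_in_def by blast
    from someI_ex[OF this] show ?thesis using False by (simp add: c_def)
  qed (simp add: c_def is_subring_zero[OF B])
  define r where "r = Abs_poly c"
  have "coeff r = c"
    unfolding r_def by (rule Abs_poly_inverse) (use MOST_coeff_eq_0[of q] in \<open>auto elim!: MOST_mono simp: c_def\<close>)
  then show "dvd_in (polys_over B) [:p:] q"
    unfolding dvd_in_def using c by (intro bexI[of _ r]) (auto intro: polys_overI poly_eqI)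
qed

text \<open>Gauss's argument: let \<open>i\<close> and \<open>j\<close> be the least indices whose
  coefficients in \<open>a\<close> and \<open>b\<close> are not divisible by \<open>p\<close>. In
  coefficient \<open>i + j\<close> of the product every other term contains a coefficient below one
  of them, so \<open>p\<close> would divide the product of these two.\<close>

lemma prime_in_polys_over_const:
  fixes B :: "'a::idom set"
  assumes B: "is_subring B" and p: "prime_in B p"
  shows "prime_in (polys_over B) [:p:]"
  unfolding prime_in_def
proof (intro ballI impI, rule ccontr)
  fix a b assume ab: "a \<in> polys_over B" "b \<in> polys_over B" and d: "dvd_in (polys_over B) [:p:] (a * b)"
    and n: "\<not> (dvd_in (polys_over B) [:p:] a \<or> dvd_in (polys_over B) [:p:] b)"
  have ex: "\<exists>i. \<not> dvd_in B p (coeff a i)" "\<exists>i. \<not> dvd_in B p (coeff b i)"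
    using n by (simp_all add: const_dvd_in_polys_over_iff[OF B])
  obtain i where i: "\<not> dvd_in B p (coeff a i)" "\<And>k. k < i \<Longrightarrow> dvd_in B p (coeff a k)"
    using ex(1) exists_least_iff[of "\<lambda>i. \<not> dvd_in B p (coeff a i)"] by auto
  obtain j where j: "\<not> dvd_in B p (coeff b j)" "\<And>k. k < j \<Longrightarrow> dvd_in B p (coeff b k)"
    using ex(2) exists_least_iff[of "\<lambda>i. \<not> dvd_in B p (coeff b i)"] by auto
  have sumd: "dvd_in B p (sum f K)" if "\<And>k. k \<in> K \<Longrightarrow> dvd_in B p (f k)" for f and K :: "nat set"
    using that by (induction K rule: infinite_finite_induct) (auto intro: dvd_in_zero[OF B] dvd_in_add[OF B])
  have rest: "dvd_in B p (coeff a k * coeff b (i + j - k))" if "k \<in> {..i+j} - {i}" for k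
  proof (cases "k < i")
    case True
    then show ?thesis using i(2) dvd_in_mult[OF B] polys_overD[OF ab(2)] by blast
  next
    case False
    then have "i + j - k < j" using that by auto
    then show ?thesis using j(2) dvd_in_mult[OF B, of p "coeff b (i+j-k)" "coeff a k"] polys_overD[OF ab(1)]
      by (simp add: mult.commute)
  qed
  have "coeff (a * b) (i + j) = coeff a i * coeff b j + (\<Sum>k\<in>{..i+j}-{i}. coeff a k * coeff b (i + j - k))"
    unfolding coeff_mult by (subst sum.remove[of _ i]) auto
  moreover have "dvd_in B p (coeff (a * b) (i + j))"
    using d by (simp add: const_dvd_in_polys_over_iff[OF B])
  ultimately have "dvd_in B p (coeff a i * coeff b j)"
    using dvd_in_diff[OF B _ sumd[of "{..i+j}-{i}" "\<lambda>k. coeff a k * coeff b (i + j - k)", OF rest],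
        of "coeff (a * b) (i + j)"] by simp
  then show False using p i(1) j(1) polys_overD[OF ab(1)] polys_overD[OF ab(2)] unfolding prime_in_def by blast
qed

lemma prime_in_imp_primal_in:
  assumes "is_subring R" "p \<in> R" "prime_in R p" shows "primal_in R p"
  unfolding primal_in_def
proof (intro ballI impI)
  fix g h assume gh: "g \<in> R" "h \<in> R" "dvd_in R p (g * h)"
  have one: "dvd_in R 1 x" if "x \<in> R" for x using that unfolding dvd_in_def by simp
  have 1: "1 \<in> R" using assms(1) by (rule is_subring_one)
  consider "dvd_in R p g" | "dvd_in R p h" using gh assms(3) unfolding prime_in_def by blast
  then show "\<exists>c1\<in>R. \<exists>c2\<in>R. p = c1 * c2 \<and> dvd_in R c1 g \<and> dvd_in R c2 h"
  proof cases
    case 1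
    show ?thesis by (rule bexI[of _ p], rule bexI[of _ 1]) (use 1 one gh assms \<open>1 \<in> R\<close> in auto)
  next
    case 2
    show ?thesis by (rule bexI[of _ 1], rule bexI[of _ p]) (use 2 one gh assms \<open>1 \<in> R\<close> in auto)
  qed
qed

text \<open>A nonzero constant is a product of units and irreducibles of \<open>B\<close>. The
  irreducibles are prime in \<open>B\<close> and remain prime in the polynomial ring, and primal
  elements multiply.\<close>

lemma primal_in_polys_over_const:
  fixes B :: "'a::idom set"
  assumes B: "is_subring B" and N: "noetherian B" and U: "irreducibles_prime B" and c: "c \<in> B" "c \<noteq> 0"
  shows "primal_in (polys_over B) [:c:]"
proof (rule noetherian_factorization_induct[OF B N _ _ _ c])
  note R = is_subring_polys_over[OF B]
  show "primal_in (polys_over B) [:c:]" if cB: "c \<in> B" and unit: "dvd_in B c 1" for c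
  proof -
    obtain e where e: "e \<in> B" "1 = c * e" using unit unfolding dvd_in_def by blast
    have "dvd_in (polys_over B) [:c:] x" if "x \<in> polys_over B" for x
      unfolding dvd_in_def using e that smult_in_polys_over[OF B]
      by (intro bexI[of _ "smult e x"]) (auto simp: mult_ac)
    then have "prime_in (polys_over B) [:c:]" unfolding prime_in_def by blast
    then show ?thesis using prime_in_imp_primal_in[OF R const_in_polys_over[OF B cB]] by blast
  qed
  show "primal_in (polys_over B) [:c:]" if "irreducible_in B c" for c
    using that U prime_in_polys_over_const[OF B] prime_in_imp_primal_in[OF R] const_in_polys_over[OF B]
    unfolding irreducibles_prime_def irreducible_in_def by blast
  show "primal_in (polys_over B) [:a * b:]"
    if "a \<in> B" "b \<in> B" "a \<noteq> 0" "primal_in (polys_over B) [:a:]" "primal_in (polys_over B) [:b:]" for a b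
    using primal_in_mult[OF R that(4) _ _ that(5)] const_in_polys_over[OF B] that by (simp add: mult.commute)
qed

text \<open>Pseudo-division by an element of least degree: it replaces division with remainder over
  the fraction field of \<open>B\<close>, without forming that field.\<close>

lemma polys_over_ideal_min:
  fixes B :: "'a::idom set"
  assumes B: "is_subring B" and J: "is_ideal (polys_over B) J" and f0: "f0 \<in> J" "f0 \<noteq> 0"
  obtains g where "g \<in> J" "g \<noteq> 0" "degree g \<le> degree f0"
    "\<And>f. f \<in> J \<Longrightarrow> \<exists>c\<in>B. c \<noteq> 0 \<and> dvd_in (polys_over B) g (smult c f)"
proof -
  let ?R = "polys_over B"
  note R = is_subring_polys_over[OF B]
  obtain g where g: "g \<in> J" "g \<noteq> 0" and gmin: "\<And>h. h \<in> J \<Longrightarrow> h \<noteq> 0 \<Longrightarrow> degree g \<le> degree h"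
    using arg_min_nat_lemma[of "\<lambda>h. h \<in> J \<and> h \<noteq> 0" f0 degree] f0 by blast
  have gR: "g \<in> ?R" using is_ideal_subset[OF J g(1)] .
  have "\<exists>c\<in>B. c \<noteq> 0 \<and> dvd_in ?R g (smult c f)" if "f \<in> J" for f
    using that
  \<comment> \<open>The measure puts 0 strictly below the nonzero constants, which also have degree
    0.\<close>
  proof (induction "if f = 0 then 0 else Suc (degree f)" arbitrary: f rule: less_induct)
    case less
    show ?case
    proof (cases "f = 0")
      case True
      then show ?thesis using is_subring_one[OF B] dvd_in_zero[OF R] by (intro bexI[of _ 1]) auto
    next
      case False
      have fR: "f \<in> ?R" using is_ideal_subset[OF J less(2)] .
      let ?k = "degree f - degree g"
      define m where "m = monom (lead_coeff f) ?k"
      define f' where "f' = smult (lead_coeff g) f - m * g"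
      have mR: "m \<in> ?R" unfolding m_def by (rule monom_in_polys_over[OF B polys_overD[OF fR]])
      have le: "degree g \<le> degree f" using gmin less(2) False by blast
      have lgB: "lead_coeff g \<in> B" by (rule polys_overD[OF gR])
      have "smult (lead_coeff g) f \<in> J"
        using is_ideal_mult[OF J const_in_polys_over[OF B lgB] less(2)] by simp
      then have f'J: "f' \<in> J"
        unfolding f'_def using is_ideal_diff[OF R J] is_ideal_mult[OF J mR g(1)] by blast
      have "degree (m * g) \<le> degree f"
        using degree_mult_le[of m g] degree_monom_le[of "lead_coeff f" ?k] le unfolding m_def by linarith
      then have d1: "degree f' \<le> degree f" unfolding f'_def by (intro degree_diff_le) auto
      have d2: "coeff f' (degree f) = 0"
        using le unfolding f'_def m_def by (simp add: coeff_monom_mult)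
      have "f' = 0 \<or> degree f' < degree f"
        using d1 d2 by (metis le_neq_implies_less leading_coeff_0_iff)
      then have "(if f' = 0 then 0 else Suc (degree f')) < (if f = 0 then 0 else Suc (degree f))"
        using False by auto
      from less(1)[OF this f'J] obtain c h where c: "c \<in> B" "c \<noteq> 0" and h: "h \<in> ?R" "smult c f' = g * h"
        unfolding dvd_in_def by blast
      have "smult (c * lead_coeff g) f = g * (h + smult c m)"
        using h(2) unfolding f'_def by (simp add: smult_diff_right algebra_simps)
      moreover have "h + smult c m \<in> ?R"
        using is_subring_add[OF R h(1) smult_in_polys_over[OF B c(1) mR]] .
      moreover have "c * lead_coeff g \<in> B" "c * lead_coeff g \<noteq> 0"
        using c lgB g(2) is_subring_mult[OF B] by auto
      ultimately show ?thesis unfolding dvd_in_def by blast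
    qed
  qed
  then show thesis using that g gmin f0 by blast
qed

text \<open>Gauss's theorem. For \<open>p\<close> of positive degree dividing \<open>a * b\<close>,
  a least-degree element \<open>g\<close> of the ideal generated by \<open>p\<close> and
  \<open>a\<close> satisfies \<open>c p = g h\<close>; splitting the constant \<open>c\<close> along
  \<open>g\<close> and \<open>h\<close> writes \<open>p\<close> as a product. Irreducibility leaves
  two cases: \<open>g\<close> is constant and \<open>p\<close> divides \<open>g b\<close>, or
  \<open>g\<close> is a multiple of \<open>p\<close> and divides a constant multiple of
  \<open>a\<close>. Either way a constant remains to be cancelled.\<close>

lemma irreducibles_prime_polys_over:
  fixes B :: "'a::idom set"
  assumes B: "is_subring B" and N: "noetherian B" and U: "irreducibles_prime B"
  shows "irreducibles_prime (polys_over B)"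
  unfolding irreducibles_prime_def
proof (intro allI impI)
  let ?R = "polys_over B"
  note R = is_subring_polys_over[OF B]
  fix p assume p: "irreducible_in ?R p"
  have pR: "p \<in> ?R" and p0: "p \<noteq> 0" using p unfolding irreducible_in_def by auto
  have unit_deg: "degree e = 0" if "dvd_in ?R e 1" for e
    using that unfolding dvd_in_def by (metis add_is_0 degree_1 degree_mult_eq mult_eq_0_iff zero_neq_one)
  show "prime_in ?R p"
  proof (cases "degree p = 0")
    case True
    then obtain c where c: "p = [:c:]" by (metis degree_eq_zeroE)
    have unit: "dvd_in ?R [:x:] 1 \<longleftrightarrow> dvd_in B x 1" if "x \<in> B" for x
    proof
      assume "dvd_in ?R [:x:] 1"
      from this[unfolded const_dvd_in_polys_over_iff[OF B], rule_format, of 0] show "dvd_in B x 1" by simp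
    qed (auto simp: const_dvd_in_polys_over_iff[OF B] coeff_1 intro: dvd_in_zero[OF B])
    have cB: "c \<in> B" using polys_overD[OF pR, of 0] c by simp
    have "irreducible_in B c"
      unfolding irreducible_in_def
    proof (intro conjI ballI impI)
      fix a b assume ab: "a \<in> B" "b \<in> B" "c = a * b"
      have "p = [:a:] * [:b:]" using ab c by (simp add: mult.commute)
      then have "dvd_in ?R [:a:] 1 \<or> dvd_in ?R [:b:] 1"
        using p const_in_polys_over[OF B] ab unfolding irreducible_in_def by blast
      then show "dvd_in B a 1 \<or> dvd_in B b 1" using unit ab by simp
    qed (use cB p unit[OF cB] c in \<open>auto simp: irreducible_in_def\<close>)
    then show ?thesis
      using U prime_in_polys_over_const[OF B] c unfolding irreducibles_prime_def by blast
  next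
    case False
    \<comment> \<open>The constant \<open>e\<close> splits into \<open>e1\<close>, dividing
      \<open>p\<close>, and \<open>e2\<close>, dividing the quotient. As \<open>e1\<close> has
      degree 0, the cofactor \<open>p'\<close> has positive degree and is no unit; so
      \<open>e1\<close> is a unit by irreducibility, and \<open>e2\<close> cancels.\<close>
    have cancel: "dvd_in ?R p b" if pe: "dvd_in ?R p (smult e b)" and e: "e \<in> B" "e \<noteq> 0" and b: "b \<in> ?R" for e b
    proof -
      obtain k where k: "k \<in> ?R" "smult e b = p * k" using pe unfolding dvd_in_def by blast
      have "dvd_in ?R [:e:] (p * k)" using k b unfolding dvd_in_def by (metis mult_pCons_left mult_zero_left pCons_0_0 add_0_right)
      then obtain e1 e2 p' k' where e12: "e1 \<in> ?R" "e2 \<in> ?R" "[:e:] = e1 * e2"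
        and p': "p' \<in> ?R" "p = e1 * p'" and k': "k' \<in> ?R" "k = e2 * k'"
        using primal_in_polys_over_const[OF B N U e] pR k(1) unfolding primal_in_def dvd_in_def by blast
      have nz: "e1 \<noteq> 0" "e2 \<noteq> 0" using e12(3) e(2) by auto
      have "degree e1 + degree e2 = 0" using e12(3) nz by (metis degree_mult_eq degree_pCons_0)
      then have "\<not> dvd_in ?R p' 1"
        using False p'(2) unit_deg degree_mult_le[of e1 p'] by fastforce
      then have "dvd_in ?R e1 1" using p p' e12 unfolding irreducible_in_def by blast
      then obtain f where f: "f \<in> ?R" "1 = e1 * f" unfolding dvd_in_def by blast
      have "e2 * (e1 * b) = e2 * (p * k')"
      proof -
        have "e2 * (e1 * b) = [:e:] * b" unfolding e12(3) by (simp add: mult_ac)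
        then show ?thesis using k(2) k'(2) by (simp add: mult_ac)
      qed
      then have "e1 * b = p * k'" using nz by simp
      then have "b = p * (k' * f)" using f(2) by (metis mult.assoc mult.commute mult_1_left)
      then show ?thesis using is_subring_mult[OF R k'(1) f(1)] unfolding dvd_in_def by blast
    qed
    show ?thesis
      unfolding prime_in_def
    proof (intro ballI impI)
      fix a b assume ab: "a \<in> ?R" "b \<in> ?R" and d: "dvd_in ?R p (a * b)"
      define J where "J = ideal_gen ?R {p, a}"
      have J: "is_ideal ?R J" unfolding J_def using is_ideal_ideal_gen[OF R] ab pR by auto
      have pJ: "p \<in> J" and aJ: "a \<in> J" unfolding J_def using ideal_gen_superset[OF R] by auto
      obtain g where g: "g \<in> J" "g \<noteq> 0" "\<And>f. f \<in> J \<Longrightarrow> \<exists>c\<in>B. c \<noteq> 0 \<and> dvd_in ?R g (smult c f)"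
        by (rule polys_over_ideal_min[OF B J pJ p0]) blast
      have gR: "g \<in> ?R" using is_ideal_subset[OF J g(1)] .
      have Jb: "dvd_in ?R p (f * b)" if "f \<in> J" for f
        using that unfolding J_def
      proof (induction rule: ideal_gen.induct)
        case (step f r h)
        have "dvd_in ?R p (h * b)"
          using step(3) d ab dvd_in_mult[OF R, of p p b] is_subring_one[OF R] unfolding dvd_in_def
          by (metis insertE mult.commute mult_1_left singletonD)
        then have "dvd_in ?R p (h * b * r)" using step(2) by (rule dvd_in_mult[OF R])
        then have "dvd_in ?R p (h * b * r + f * b)" using step(4) by (rule dvd_in_add[OF R])
        then show ?case by (simp add: algebra_simps)
      qed (simp add: dvd_in_zero[OF R])
      obtain c h where c: "c \<in> B" "c \<noteq> 0" and h: "h \<in> ?R" "smult c p = g * h"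
        using g(3)[OF pJ] unfolding dvd_in_def by blast
      have "dvd_in ?R [:c:] (g * h)" using h pR unfolding dvd_in_def
        by (metis mult_pCons_left mult_zero_left pCons_0_0 add_0_right)
      then obtain d1 d2 g' h' where d12: "d1 \<in> ?R" "d2 \<in> ?R" "[:c:] = d1 * d2"
        and g': "g' \<in> ?R" "g = d1 * g'" and h': "h' \<in> ?R" "h = d2 * h'"
        using primal_in_polys_over_const[OF B N U c] gR h(1) unfolding primal_in_def dvd_in_def by blast
      have nz: "d1 \<noteq> 0" "d2 \<noteq> 0" using d12(3) c by auto
      have deg: "degree d1 + degree d2 = 0" using d12(3) nz by (metis degree_mult_eq degree_pCons_0)
      have "(d1 * d2) * p = (d1 * d2) * (g' * h')"
      proof -
        have "(d1 * d2) * p = smult c p" unfolding d12(3)[symmetric] by simp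
        then show ?thesis using h(2) g'(2) h'(2) by (simp add: mult_ac)
      qed
      then have "p = g' * h'" using nz by simp
      then consider "dvd_in ?R g' 1" | "dvd_in ?R h' 1"
        using p g' h' unfolding irreducible_in_def by blast
      then show "dvd_in ?R p a \<or> dvd_in ?R p b"
      proof cases
        case 1
        then have "degree g = 0" using unit_deg deg degree_mult_le[of d1 g'] g'(2) by fastforce
        then obtain e where e: "g = [:e:]" by (metis degree_eq_zeroE)
        have "dvd_in ?R p (smult e b)" using Jb[OF g(1)] e by simp
        then show ?thesis using cancel[of e b] polys_overD[OF gR, of 0] g(2) ab e by simp
      next
        case 2
        then obtain f where f: "f \<in> ?R" "1 = h' * f" unfolding dvd_in_def by blast
        have "g = p * (f * d1)"
          using f(2) g'(2) \<open>p = g' * h'\<close> by (metis mult.assoc mult.commute mult_1_left)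
        then have pg: "dvd_in ?R p g" using is_subring_mult[OF R f(1) d12(1)] unfolding dvd_in_def by blast
        obtain c' where c': "c' \<in> B" "c' \<noteq> 0" "dvd_in ?R g (smult c' a)" using g(3)[OF aJ] by blast
        then show ?thesis using cancel[OF dvd_in_trans[OF R pg]] ab by blast
      qed
    qed
  qed
qed

section \<open>Transport along ring maps\<close>

lemma irreducible_in_reflect:
  fixes \<phi> :: "'a::comm_ring_1 \<Rightarrow> 'b::comm_ring_1"
  assumes inj: "inj_on \<phi> R" and R: "is_subring R" and one: "\<phi> 1 = 1"
    and mult: "\<And>a b. a \<in> R \<Longrightarrow> b \<in> R \<Longrightarrow> \<phi> (a * b) = \<phi> a * \<phi> b" and zero: "\<phi> 0 = 0"
    and p: "p \<in> R" "irreducible_in (\<phi> ` R) (\<phi> p)"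
  shows "irreducible_in R p"
proof -
  have dvd: "dvd_in R a b \<longleftrightarrow> dvd_in (\<phi> ` R) (\<phi> a) (\<phi> b)" if "a \<in> R" "b \<in> R" for a b
    unfolding dvd_in_def using inj_onD[OF inj] mult that is_subring_mult[OF R] by auto metis
  have dvd1: "dvd_in R a 1 \<longleftrightarrow> dvd_in (\<phi> ` R) (\<phi> a) 1" if "a \<in> R" for a
    using dvd[OF that is_subring_one[OF R]] one by simp
  show ?thesis
    unfolding irreducible_in_def
  proof (intro conjI ballI impI)
    fix a b assume ab: "a \<in> R" "b \<in> R" "p = a * b"
    then have "\<phi> p = \<phi> a * \<phi> b" using mult by simp
    then show "dvd_in R a 1 \<or> dvd_in R b 1"
      using p(2) ab dvd1 unfolding irreducible_in_def by blast
  qed (use p dvd1 zero in \<open>auto simp: irreducible_in_def\<close>)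
qed

lemma irreducibles_prime_image:
  fixes \<phi> :: "'a::comm_ring_1 \<Rightarrow> 'b::comm_ring_1"
  assumes inj: "inj_on \<phi> R" and R: "is_subring R" and one: "\<phi> 1 = 1"
    and mult: "\<And>a b. a \<in> R \<Longrightarrow> b \<in> R \<Longrightarrow> \<phi> (a * b) = \<phi> a * \<phi> b" and zero: "\<phi> 0 = 0"
    and U: "irreducibles_prime R"
  shows "irreducibles_prime (\<phi> ` R)"
  unfolding irreducibles_prime_def
proof (intro allI impI)
  fix q assume q: "irreducible_in (\<phi> ` R) q"
  then obtain p where p: "p \<in> R" "q = \<phi> p" unfolding irreducible_in_def by blast
  have dvd: "dvd_in R a b \<longleftrightarrow> dvd_in (\<phi> ` R) (\<phi> a) (\<phi> b)" if "a \<in> R" "b \<in> R" for a b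
    unfolding dvd_in_def using inj_onD[OF inj] mult that is_subring_mult[OF R] by auto metis
  have "prime_in R p"
    using irreducible_in_reflect[OF inj R one mult zero p(1)] q p(2) U unfolding irreducibles_prime_def by blast
  then show "prime_in (\<phi> ` R) q"
    unfolding prime_in_def using dvd p is_subring_mult[OF R] by (auto simp: mult[symmetric])
qed

lemma noetherian_image:
  fixes \<phi> :: "'a::comm_ring_1 \<Rightarrow> 'b::comm_ring_1"
  assumes R: "is_subring R" and N: "noetherian R"
    and mult: "\<And>a b. \<phi> (a * b) = \<phi> a * \<phi> b" and add: "\<And>a b. \<phi> (a + b) = \<phi> a + \<phi> b"
    and zero: "\<phi> 0 = 0"
  shows "noetherian (\<phi> ` R)"
  unfolding noetherian_def
proof (intro allI impI)
  fix I assume I: "is_ideal (\<phi> ` R) I"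
  define J where "J = {a\<in>R. \<phi> a \<in> I}"
  have "is_ideal R J"
    using I R unfolding is_ideal_def J_def
    by (auto simp: add mult zero intro: is_subring_zero is_subring_add is_subring_mult)
  then obtain G where G: "finite G" "G \<subseteq> J" "J \<subseteq> ideal_gen R G" using N unfolding noetherian_def by blast
  have "\<phi> a \<in> ideal_gen (\<phi> ` R) (\<phi> ` G)" if "a \<in> ideal_gen R G" for a
    using that by (induction rule: ideal_gen.induct) (auto simp: add mult zero intro: ideal_gen.intros)
  moreover have "I \<subseteq> \<phi> ` J" using is_ideal_subset[OF I] unfolding J_def by auto
  ultimately have "I \<subseteq> ideal_gen (\<phi> ` R) (\<phi> ` G)" using G(3) by blast
  then show "\<exists>G. finite G \<and> G \<subseteq> I \<and> I \<subseteq> ideal_gen (\<phi> ` R) G"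
    using G(1,2) by (intro exI[of _ "\<phi> ` G"]) (auto simp: J_def)
qed

section \<open>Extending derivations\<close>

text \<open>A derivation of the ambient ring itself; working modulo an ideal \<open>P\<close> only
  means that \<open>P\<close> is mapped into \<open>P\<close>.\<close>

definition is_derivation :: "('a::comm_ring_1 \<Rightarrow> 'a) \<Rightarrow> bool" where
  "is_derivation D \<longleftrightarrow> (\<forall>a b. D (a + b) = D a + D b \<and> D (a * b) = D a * b + a * D b)"

definition is_prime_ideal :: "'a::comm_ring_1 set \<Rightarrow> bool" where
  "is_prime_ideal P \<longleftrightarrow> is_ideal UNIV P \<and> P \<noteq> UNIV \<and> (\<forall>a b. a * b \<in> P \<longrightarrow> a \<in> P \<or> b \<in> P)"

lemma is_derivation_add: "is_derivation D \<Longrightarrow> D (a + b) = D a + D b"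
  and is_derivation_mult: "is_derivation D \<Longrightarrow> D (a * b) = D a * b + a * D b"
  by (auto simp: is_derivation_def)

lemma is_derivation_zero: "is_derivation D \<Longrightarrow> D 0 = 0"
  using is_derivation_add[of D 0 0] by simp

lemma is_derivation_diff: "is_derivation D \<Longrightarrow> D (a - b) = D a - D b"
  using is_derivation_add[of D "a - b" b] by simp

lemma is_derivation_poly:
  assumes D: "is_derivation D" and Q: "\<And>i. D (coeff Q i) = 0" and x: "D x = 1"
  shows "D (poly Q x) = poly (pderiv Q) x"
  using Q
proof (induction Q)
  case 0
  then show ?case using is_derivation_zero[OF D] by simp
next
  case (pCons a Q)
  have "D a = 0" using pCons(3)[of 0] by simp
  moreover have "D (poly Q x) = poly (pderiv Q) x"
    using pCons(2) pCons(3)[of "Suc _"] by simp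
  ultimately show ?case
    by (simp add: is_derivation_add[OF D] is_derivation_mult[OF D] x pderiv_pCons)
qed

text \<open>The new derivation is \<open>\<partial>q \<cdot> D - Dq \<cdot> \<partial>\<close>, where \<open>q\<close> plays the role of a minimal polynomial
  of \<open>x\<close> modulo \<open>P\<close>; it kills \<open>q\<close>. If \<open>x\<close> is transcendental modulo \<open>P\<close>, then \<open>D\<close> itself works.\<close>

lemma derivation_extend:
  fixes P :: "'a::idom set"
  assumes P: "is_prime_ideal P" and char: "\<And>n a. of_nat (Suc n) * a \<in> P \<Longrightarrow> a \<in> P"
    and B: "is_subring B" and D: "is_derivation D" and d: "is_derivation d"
    and dB: "\<And>b. b \<in> B \<Longrightarrow> d b = 0" and dx: "d x = 1"
    and DP: "\<And>b. b \<in> B \<Longrightarrow> b \<in> P \<Longrightarrow> D b \<in> P"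
  obtains s t where "s \<notin> P"
    "\<And>q. q \<in> polys_over B \<Longrightarrow> poly q x \<in> P \<Longrightarrow> s * D (poly q x) + t * d (poly q x) \<in> P"
proof -
  have PI: "is_ideal UNIV P" and prime: "\<And>a b. a * b \<in> P \<Longrightarrow> a \<in> P \<or> b \<in> P" and one: "1 \<notin> P"
    using P is_ideal_mult[of UNIV P _ 1] unfolding is_prime_ideal_def by auto
  have U: "is_subring (UNIV::'a set)" by (simp add: is_subring_def)
  note Padd = is_ideal_add[OF PI] and Pdiff = is_ideal_diff[OF U PI]
    and Pmult = is_ideal_mult[OF PI UNIV_I]
  have Pmult': "a \<in> P \<Longrightarrow> a * r \<in> P" for a r using Pmult[of a r] by (simp add: mult.commute)
  define M where "M q \<longleftrightarrow> q \<in> polys_over B \<and> poly q x \<in> P \<and> lead_coeff q \<notin> P" for q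
  have strip: "\<exists>r \<in> polys_over B. h = monom (lead_coeff h) (degree h) + r \<and> (r = 0 \<or> degree r < degree h)"
    if "h \<in> polys_over B" for h :: "'a poly"
  proof -
    define r where "r = h - monom (lead_coeff h) (degree h)"
    have "degree r \<le> degree h" unfolding r_def by (intro degree_diff_le) (auto simp: degree_monom_le)
    moreover have "coeff r (degree h) = 0" by (simp add: r_def)
    ultimately have "r = 0 \<or> degree r < degree h" by (metis le_neq_implies_less leading_coeff_0_iff)
    moreover have "r \<in> polys_over B" unfolding r_def
      using is_subring_diff[OF is_subring_polys_over[OF B]] monom_in_polys_over[OF B] polys_overD that by blast
    ultimately show ?thesis by (intro bexI[of _ r]) (simp_all add: r_def)
  qed
  define \<mu> where "\<mu> h = (if h = 0 then 0 else Suc (degree h))" for h :: "'a poly"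
  have key: "s * D (poly h x) + t * d (poly h x) \<in> P"
    if "h \<in> polys_over B" "poly h x \<in> P"
      and red: "\<And>h'. h' \<in> polys_over B \<Longrightarrow> poly h' x \<in> P \<Longrightarrow> lead_coeff h' \<notin> P \<Longrightarrow>
        (\<And>h''. h'' \<in> polys_over B \<Longrightarrow> poly h'' x \<in> P \<Longrightarrow> \<mu> h'' < \<mu> h' \<Longrightarrow> s * D (poly h'' x) + t * d (poly h'' x) \<in> P)
        \<Longrightarrow> s * D (poly h' x) + t * d (poly h' x) \<in> P"
    for h s t
    using that(1,2)
  proof (induction "\<mu> h" arbitrary: h rule: less_induct)
    case less
    show ?case
    proof (cases "lead_coeff h \<in> P")
      case False
      show ?thesis by (rule red[OF less(2,3) False]) (rule less(1))
    next
      case True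
      show ?thesis
      proof (cases "h = 0")
        case True
        then show ?thesis using is_ideal_zero[OF PI] D d by (simp add: is_derivation_zero)
      next
        case False
        obtain r where r: "r \<in> polys_over B" "h = monom (lead_coeff h) (degree h) + r" "r = 0 \<or> degree r < degree h"
          using strip[OF less(2)] by blast
        let ?a = "lead_coeff h"
        have aB: "?a \<in> B" using polys_overD[OF less(2)] .
        let ?y = "x ^ degree h"
        have e: "poly h x = ?a * ?y + poly r x" by (subst r(2)) (simp add: poly_monom)
        have rP: "poly r x \<in> P" using Pdiff[OF less(3) Pmult'[OF True, of ?y]] e by simp
        have "\<mu> r < \<mu> h" using r(3) False by (auto simp: \<mu>_def)
        from less(1)[OF this r(1) rP] have IH: "s * D (poly r x) + t * d (poly r x) \<in> P" .
        have E: "s * D (?a * ?y) + t * d (?a * ?y) = D ?a * (s * ?y) + ?a * (s * D ?y + t * d ?y)"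
          using dB[OF aB] by (simp add: is_derivation_mult[OF D] is_derivation_mult[OF d] algebra_simps)
        have "(D ?a * (s * ?y) + ?a * (s * D ?y + t * d ?y)) + (s * D (poly r x) + t * d (poly r x)) \<in> P"
          by (intro Padd[OF Padd[OF Pmult'[OF DP[OF aB True]] Pmult'[OF True]] IH])
        then show ?thesis unfolding e using E
          by (simp add: is_derivation_add[OF D] is_derivation_add[OF d] algebra_simps)
      qed
    qed
  qed
  show thesis
  proof (cases "\<exists>q. M q")
    case False
    have "1 * D (poly h x) + 0 * d (poly h x) \<in> P" if "h \<in> polys_over B" "poly h x \<in> P" for h
      by (rule key[OF that]) (use False M_def in blast)
    then show thesis using that[of 1 0] one by blast
  next
    case True
    then obtain q where q: "M q" and qmin: "\<And>h. M h \<Longrightarrow> degree q \<le> degree h"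
      using arg_min_nat_lemma[of M _ degree] by blast
    have qB: "q \<in> polys_over B" and qP: "poly q x \<in> P" and lq: "lead_coeff q \<notin> P" using q by (auto simp: M_def)
    have dq: "d (poly q x) = poly (pderiv q) x"
      by (rule is_derivation_poly[OF d _ dx]) (use dB polys_overD[OF qB] in blast)
    have deg: "degree q > 0"
    proof (rule ccontr)
      assume "\<not> degree q > 0"
      then obtain c where "q = [:c:]" by (metis degree_eq_zeroE gr0I)
      then show False using qP lq by simp
    qed
    \<comment> \<open>\<open>d\<close> is differentiation by \<open>x\<close> here, so
      \<open>s\<close> is the derivative of \<open>q\<close> at \<open>x\<close>; with this
      \<open>t\<close> the combination \<open>s D + t d\<close> sends \<open>q(x)\<close> to
      0.\<close>
    define s where "s = d (poly q x)"
    define t where "t = - D (poly q x)"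
    have lpd: "coeff (pderiv q) (degree q - 1) = of_nat (Suc (degree q - 1)) * lead_coeff q"
      using deg by (simp add: coeff_pderiv)
    \<comment> \<open>Otherwise \<open>pderiv q\<close>, whose leading coefficient lies outside
      \<open>P\<close> by \<open>char\<close>, would compete with \<open>q\<close> at a smaller
      degree.\<close>
    have "s \<notin> P"
    proof
      assume sP: "s \<in> P"
      have nP: "coeff (pderiv q) (degree q - 1) \<notin> P" using lpd lq char by metis
      then have "coeff (pderiv q) (degree q - 1) \<noteq> 0" using is_ideal_zero[OF PI] by auto
      moreover have "degree (pderiv q) \<le> degree q - 1"
        by (rule degree_le) (use deg in \<open>auto simp: coeff_pderiv coeff_eq_0\<close>)
      ultimately have "degree (pderiv q) = degree q - 1" by (simp add: le_antisym le_degree)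
      then have "M (pderiv q)" unfolding M_def using nP sP dq pderiv_in_polys_over[OF B qB] by (simp add: s_def)
      then show False using qmin[of "pderiv q"] \<open>degree (pderiv q) = _\<close> deg by simp
    qed
    moreover have "s * D (poly h x) + t * d (poly h x) \<in> P" if "h \<in> polys_over B" "poly h x \<in> P" for h
    proof (rule key[OF that])
      fix h assume h: "h \<in> polys_over B" "poly h x \<in> P" "lead_coeff h \<notin> P"
      assume IH: "\<And>h''. h'' \<in> polys_over B \<Longrightarrow> poly h'' x \<in> P \<Longrightarrow> \<mu> h'' < \<mu> h \<Longrightarrow> s * D (poly h'' x) + t * d (poly h'' x) \<in> P"
      define E where "E a = s * D a + t * d a" for a
      have Ediff: "E (a - b) = E a - E b" and Emult: "E (a * b) = E a * b + a * E b" for a b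
        by (auto simp: E_def is_derivation_diff[OF D] is_derivation_diff[OF d]
            is_derivation_mult[OF D] is_derivation_mult[OF d] algebra_simps)
      have Eq: "E (poly q x) = 0" by (simp add: E_def s_def t_def)
      have le: "degree q \<le> degree h" using qmin h by (simp add: M_def)
      have h0: "h \<noteq> 0" using h(3) is_ideal_zero[OF PI] by auto
      define m where "m = monom (lead_coeff h) (degree h - degree q)"
      define h' where "h' = smult (lead_coeff q) h - m * q"
      have mB: "m \<in> polys_over B" unfolding m_def using monom_in_polys_over[OF B] polys_overD[OF h(1)] by blast
      have h'B: "h' \<in> polys_over B"
        unfolding h'_def using smult_in_polys_over[OF B polys_overD[OF qB] h(1)]
          is_subring_mult[OF is_subring_polys_over[OF B] mB qB] is_subring_diff[OF is_subring_polys_over[OF B]] by blast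
      have ph': "poly h' x = lead_coeff q * poly h x - poly m x * poly q x" by (simp add: h'_def)
      have h'P: "poly h' x \<in> P" unfolding ph' by (intro Pdiff Pmult h(2) qP)
      have "degree (m * q) \<le> degree h"
        using degree_mult_le[of m q] degree_monom_le[of "lead_coeff h" "degree h - degree q"] le unfolding m_def by linarith
      then have "degree h' \<le> degree h" unfolding h'_def by (intro degree_diff_le) auto
      moreover have "coeff h' (degree h) = 0"
        using le unfolding h'_def m_def by (simp add: coeff_monom_mult)
      ultimately have "h' = 0 \<or> degree h' < degree h" by (metis le_neq_implies_less leading_coeff_0_iff)
      then have "\<mu> h' < \<mu> h" using h0 by (auto simp: \<mu>_def)
      from IH[OF h'B h'P this] have "E (poly h' x) \<in> P" by (simp add: E_def)
      then have *: "E (lead_coeff q) * poly h x + lead_coeff q * E (poly h x) - E (poly m x) * poly q x \<in> P"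
        unfolding ph' Ediff Emult Eq by simp
      \<comment> \<open>Since \<open>h(x)\<close> and \<open>q(x)\<close> lie in \<open>P\<close>,
        the reduction puts \<open>E (poly h x)\<close> into \<open>P\<close> up to the factor
        \<open>lead_coeff q\<close>, which primality removes.\<close>
      have "lead_coeff q * E (poly h x) = (E (lead_coeff q) * poly h x + lead_coeff q * E (poly h x) - E (poly m x) * poly q x)
          - E (lead_coeff q) * poly h x + E (poly m x) * poly q x" by simp
      moreover have "\<dots> \<in> P" by (intro Padd Pdiff * Pmult h(2) qP)
      ultimately have "lead_coeff q * E (poly h x) \<in> P" by simp
      then show "s * D (poly h x) + t * d (poly h x) \<in> P" using prime lq by (auto simp: E_def)
    qed
    ultimately show thesis using that by blast
  qed
qed

section \<open>The ring of polynomial functions\<close>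

text \<open>Polynomials enter as functions: over an infinite field nothing is lost, equality is
  extensional, and substitution is composition. The set \<open>S\<close> of admissible variables
  supplies the subrings for the induction over variables.\<close>

inductive_set polyfun_on :: "'v set \<Rightarrow> (('v \<Rightarrow> complex) \<Rightarrow> complex) set" for S where
  const: "(\<lambda>x. c) \<in> polyfun_on S"
| var: "v \<in> S \<Longrightarrow> (\<lambda>x. x v) \<in> polyfun_on S"
| add: "f \<in> polyfun_on S \<Longrightarrow> g \<in> polyfun_on S \<Longrightarrow> (\<lambda>x. f x + g x) \<in> polyfun_on S"
| mult: "f \<in> polyfun_on S \<Longrightarrow> g \<in> polyfun_on S \<Longrightarrow> (\<lambda>x. f x * g x) \<in> polyfun_on S"

lemma polyfun_on_diff:
  assumes "f \<in> polyfun_on S" "g \<in> polyfun_on S" shows "(\<lambda>x. f x - g x) \<in> polyfun_on S"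
  using polyfun_on.add[OF assms(1) polyfun_on.mult[OF polyfun_on.const[of "-1"] assms(2)]] by simp

lemma polyfun_on_mono: "f \<in> polyfun_on S \<Longrightarrow> S \<subseteq> T \<Longrightarrow> f \<in> polyfun_on T"
  by (induction rule: polyfun_on.induct) (auto intro: polyfun_on.intros)

lemma polyfun_on_cong: "f \<in> polyfun_on S \<Longrightarrow> (\<And>v. v \<in> S \<Longrightarrow> x v = y v) \<Longrightarrow> f x = f y"
  by (induction rule: polyfun_on.induct) auto

lemma polyfun_on_line:
  "f \<in> polyfun_on S \<Longrightarrow> \<exists>q. \<forall>t. f (\<lambda>v. x v + t * (y v - x v)) = poly q t"
proof (induction rule: polyfun_on.induct)
  case (const c)
  show ?case by (rule exI[of _ "[:c:]"]) simp
next
  case (var v)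
  show ?case by (rule exI[of _ "[:x v, y v - x v:]"]) (simp add: algebra_simps)
next
  case (add f g)
  then obtain p q where "\<forall>t. f (\<lambda>v. x v + t * (y v - x v)) = poly p t"
    "\<forall>t. g (\<lambda>v. x v + t * (y v - x v)) = poly q t" by blast
  then show ?case by (intro exI[of _ "p + q"]) simp
next
  case (mult f g)
  then obtain p q where "\<forall>t. f (\<lambda>v. x v + t * (y v - x v)) = poly p t"
    "\<forall>t. g (\<lambda>v. x v + t * (y v - x v)) = poly q t" by blast
  then show ?case by (intro exI[of _ "p * q"]) simp
qed

text \<open>On the line from \<open>x\<close> to \<open>y\<close> the functions become complex
  polynomials with product zero. The first is nonzero at parameter 0, so the second is zero, in
  particular at parameter 1, which is \<open>y\<close>.\<close>

lemma polyfun_on_no_zero_divisors: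
  assumes "f \<in> polyfun_on S" "g \<in> polyfun_on S" "\<And>x. f x * g x = 0" "f x \<noteq> 0"
  shows "g y = 0"
proof -
  obtain p q where p: "\<And>t. f (\<lambda>v. x v + t * (y v - x v)) = poly p t"
    and q: "\<And>t. g (\<lambda>v. x v + t * (y v - x v)) = poly q t"
    using polyfun_on_line[OF assms(1)] polyfun_on_line[OF assms(2)] by metis
  have "poly (p * q) t = 0" for t using assms(3) by (simp add: p[symmetric] q[symmetric])
  then have "p * q = 0" using poly_all_0_iff_0 by blast
  moreover have "p \<noteq> 0" using p[of 0] assms(4) by auto
  ultimately have "q = 0" by simp
  then show ?thesis using q[of 1] by simp
qed

text \<open>A type rather than a set, so that the class \<open>idom\<close> and the type
  \<open>'v pfun poly\<close> become available.\<close>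

typedef 'v pfun = "polyfun_on (UNIV :: 'v set)" morphisms pev Abs_pfun
  by (rule exI, rule polyfun_on.const)

lemma pev_Abs: "f \<in> polyfun_on UNIV \<Longrightarrow> pev (Abs_pfun f) = f"
  by (rule Abs_pfun_inverse)

lemma pfun_eqI: "(\<And>x. pev f x = pev g x) \<Longrightarrow> f = g"
  by (metis ext pev_inject)

instantiation pfun :: (type) comm_ring_1
begin

definition "0 = Abs_pfun (\<lambda>x. 0)"
definition "1 = Abs_pfun (\<lambda>x. 1)"
definition "f + g = Abs_pfun (\<lambda>x. pev f x + pev g x)"
definition "f - g = Abs_pfun (\<lambda>x. pev f x - pev g x)"
definition "- f = Abs_pfun (\<lambda>x. 0 - pev f x)"
definition "f * g = Abs_pfun (\<lambda>x. pev f x * pev g x)"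

lemma pev_simps:
  "pev 0 x = 0" "pev 1 x = 1" "pev (f + g) x = pev f x + pev g x" "pev (f - g) x = pev f x - pev g x"
  "pev (- f) x = - pev f x" "pev (f * g) x = pev f x * pev g x"
  using polyfun_on_diff[OF polyfun_on.const[of 0] pev[of f]]
  unfolding zero_pfun_def one_pfun_def plus_pfun_def minus_pfun_def uminus_pfun_def times_pfun_def
  by (simp_all add: pev_Abs polyfun_on.intros polyfun_on_diff pev)

instance
proof
  show "(0 :: 'a pfun) \<noteq> 1" by (metis pev_simps(1,2) zero_neq_one)
qed (rule pfun_eqI, simp add: pev_simps algebra_simps)+

end

declare pev_simps [simp]

instance pfun :: (type) idom
proof
  fix f g :: "'a pfun" assume "f \<noteq> 0" "g \<noteq> 0"
  then obtain x y where "pev f x \<noteq> 0" "pev g y \<noteq> 0" by (metis pfun_eqI pev_simps(1))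
  then have "\<exists>z. pev f z * pev g z \<noteq> 0"
    using polyfun_on_no_zero_divisors[OF pev pev, of f g] by blast
  then show "f * g \<noteq> 0" by (metis pev_simps(1) pev_simps(6))
qed

lemma pev_sum [simp]: "pev (sum f A) x = (\<Sum>a\<in>A. pev (f a) x)"
  by (induction A rule: infinite_finite_induct) auto

lemma pev_power [simp]: "pev (f ^ n) x = pev f x ^ n"
  by (induction n) auto

lemma pev_of_nat [simp]: "pev (of_nat n) x = of_nat n"
  by (induction n) auto

lemma pev_numeral [simp]: "pev (numeral n) x = numeral n"
  by (metis of_nat_numeral pev_of_nat)

definition pconst :: "complex \<Rightarrow> 'v pfun" where "pconst c = Abs_pfun (\<lambda>x. c)"
definition pvar :: "'v \<Rightarrow> 'v pfun" where "pvar v = Abs_pfun (\<lambda>x. x v)"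

lemma pev_pconst [simp]: "pev (pconst c) x = c"
  and pev_pvar [simp]: "pev (pvar v) x = x v"
  by (simp_all add: pconst_def pvar_def pev_Abs polyfun_on.const polyfun_on.var)

lemma pfun_induct [case_names const var add mult]:
  assumes "\<And>c. P (pconst c)" "\<And>v. P (pvar v)"
    "\<And>f g. P f \<Longrightarrow> P g \<Longrightarrow> P (f + g)" "\<And>f g. P f \<Longrightarrow> P g \<Longrightarrow> P (f * g)"
  shows "P f"
proof -
  have "P (Abs_pfun h)" if "h \<in> polyfun_on UNIV" for h
    using that
  proof (induction rule: polyfun_on.induct)
    case (add f g)
    then have "Abs_pfun (\<lambda>x. f x + g x) = Abs_pfun f + Abs_pfun g" by (simp add: plus_pfun_def pev_Abs)
    then show ?case using assms add by simp
  next
    case (mult f g)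
    then have "Abs_pfun (\<lambda>x. f x * g x) = Abs_pfun f * Abs_pfun g" by (simp add: times_pfun_def pev_Abs)
    then show ?case using assms mult by simp
  qed (use assms in \<open>auto simp: pconst_def pvar_def\<close>)
  then show ?thesis using pev[of f] by (metis pev_inverse)
qed

section \<open>Functions of some of the variables\<close>

definition pfuns_on :: "'v set \<Rightarrow> 'v pfun set" where
  "pfuns_on S = {f. pev f \<in> polyfun_on S}"

lemma pfuns_on_UNIV [simp]: "pfuns_on UNIV = UNIV"
  using pev by (auto simp: pfuns_on_def)

lemma pfuns_on_cong: "f \<in> pfuns_on S \<Longrightarrow> (\<And>v. v \<in> S \<Longrightarrow> x v = y v) \<Longrightarrow> pev f x = pev f y"
  unfolding pfuns_on_def using polyfun_on_cong by blast

lemma pev_fun_simps: "pev (1 :: 'v pfun) = (\<lambda>x. 1)" "pev (f - g) = (\<lambda>x. pev f x - pev g x)"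
  "pev (f * g) = (\<lambda>x. pev f x * pev g x)" "pev (pconst c) = (\<lambda>x. c)" "pev (pvar v) = (\<lambda>x. x v)"
  by auto

lemma pconst_in_pfuns_on [simp]: "pconst c \<in> pfuns_on S"
  and pvar_in_pfuns_on: "v \<in> S \<Longrightarrow> pvar v \<in> pfuns_on S"
  by (auto simp: pfuns_on_def pev_fun_simps intro: polyfun_on.intros)

lemma is_subring_pfuns_on: "is_subring (pfuns_on S)"
  by (auto simp: is_subring_def pfuns_on_def pev_fun_simps intro: polyfun_on.intros polyfun_on_diff)

lemma pfuns_on_empty: "f \<in> pfuns_on {} \<Longrightarrow> \<exists>c. f = pconst c"
  using pfuns_on_cong[of f "{}"] by (metis empty_iff pev_pconst pfun_eqI)

definition pspec :: "'v pfun poly \<Rightarrow> ('v \<Rightarrow> complex) \<Rightarrow> complex poly" where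
  "pspec q x = map_poly (\<lambda>f. pev f x) q"

lemma coeff_pspec [simp]: "coeff (pspec q x) i = pev (coeff q i) x"
  by (simp add: pspec_def coeff_map_poly)

lemma poly_pspec: "poly (pspec q x) (pev f x) = pev (poly q f) x"
  by (induction q) (simp_all add: pspec_def map_poly_pCons)

lemma poly_pspec_upd:
  assumes "q \<in> polys_over (pfuns_on S)" "v \<notin> S"
  shows "poly (pspec q x) t = pev (poly q (pvar v)) (x(v := t))"
proof -
  have "pspec q (x(v := t)) = pspec q x"
    using assms by (intro poly_eqI) (auto intro!: pfuns_on_cong dest: polys_overD)
  then show ?thesis using poly_pspec[of q "x(v := t)" "pvar v"] by simp
qed

text \<open>Since the coefficients are free of \<open>v\<close>, the value of
  \<open>poly q (pvar v)\<close> at \<open>x(v := t)\<close> is that of the specialized polynomial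
  at \<open>t\<close>. Equal functions thus have equal specializations at every point, hence equal
  coefficients.\<close>

lemma inj_on_poly_pvar:
  assumes "v \<notin> S" shows "inj_on (\<lambda>q. poly q (pvar v)) (polys_over (pfuns_on S))"
proof (rule inj_onI)
  fix p q :: "'a pfun poly"
  assume p: "p \<in> polys_over (pfuns_on S)" and q: "q \<in> polys_over (pfuns_on S)"
    and eq: "poly p (pvar v) = poly q (pvar v)"
  have "pspec p x = pspec q x" for x
    using poly_pspec_upd[OF p assms] poly_pspec_upd[OF q assms] eq
    by (metis poly_eq_poly_eq_iff ext)
  then show "p = q" by (metis coeff_pspec pfun_eqI poly_eqI)
qed

text \<open>The bridge between the two kinds of polynomials: through it the theorems on
  \<open>polys_over\<close> become steps of the induction over variables.\<close>

lemma pfuns_on_insert: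
  "pfuns_on (insert v S) = (\<lambda>q. poly q (pvar v)) ` polys_over (pfuns_on S)"
proof
  let ?R = "polys_over (pfuns_on S)"
  note R = is_subring_polys_over[OF is_subring_pfuns_on]
  have "\<exists>q\<in>?R. pev (poly q (pvar v)) = f" if "f \<in> polyfun_on (insert v S)" for f
    using that
  proof (induction rule: polyfun_on.induct)
    case (const c)
    show ?case
      by (rule bexI[of _ "[:pconst c:]"]) (auto intro: const_in_polys_over[OF is_subring_pfuns_on])
  next
    case (var w)
    show ?case
    proof (cases "w = v")
      case True
      have "[:0, 1:] = monom (1 :: 'a pfun) 1" by (simp add: monom_altdef)
      then have "[:0, 1:] \<in> ?R"
        by (metis is_subring_one is_subring_pfuns_on monom_in_polys_over)
      then show ?thesis using True by (intro bexI[of _ "[:0, 1:]"]) auto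
    next
      case False
      then show ?thesis using var
        by (intro bexI[of _ "[:pvar w:]"]) (auto intro: const_in_polys_over[OF is_subring_pfuns_on] pvar_in_pfuns_on)
    qed
  next
    case (add f g)
    then obtain p q where "p \<in> ?R" "q \<in> ?R" "pev (poly p (pvar v)) = f" "pev (poly q (pvar v)) = g" by blast
    then show ?case using is_subring_add[OF R] by (intro bexI[of _ "p + q"]) auto
  next
    case (mult f g)
    then obtain p q where "p \<in> ?R" "q \<in> ?R" "pev (poly p (pvar v)) = f" "pev (poly q (pvar v)) = g" by blast
    then show ?case using is_subring_mult[OF R] by (intro bexI[of _ "p * q"]) auto
  qed
  then show "pfuns_on (insert v S) \<subseteq> (\<lambda>q. poly q (pvar v)) ` ?R"
    unfolding pfuns_on_def by (auto simp: image_iff pev_inject) (metis pev_inject)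
  show "(\<lambda>q. poly q (pvar v)) ` ?R \<subseteq> pfuns_on (insert v S)"
  proof (rule image_subsetI)
    fix q assume q: "q \<in> ?R"
    have "coeff q i \<in> pfuns_on (insert v S)" for i
      using polys_overD[OF q, of i] polyfun_on_mono[of _ S "insert v S"] by (auto simp: pfuns_on_def)
    then show "poly q (pvar v) \<in> pfuns_on (insert v S)"
      unfolding poly_altdef by (intro is_subring_sum is_subring_mult is_subring_power is_subring_pfuns_on
          pvar_in_pfuns_on) auto
  qed
qed

text \<open>The constants form a field, and each further variable costs one application of Hilbert's
  and one of Gauss's theorem.\<close>

lemma noetherian_irreducibles_prime_pfuns_on:
  assumes "finite S"
  shows "noetherian (pfuns_on S) \<and> irreducibles_prime (pfuns_on S)"
  using assms
proof (induction S)
  case empty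
  have inv: "\<exists>g\<in>pfuns_on {}. g * f = 1" if f: "f \<in> pfuns_on {}" "f \<noteq> 0" for f :: "'a pfun"
  proof -
    obtain c where c: "f = pconst c" using pfuns_on_empty[OF f(1)] ..
    then have "c \<noteq> 0" using f(2) by (metis pev_pconst pev_simps(1) pfun_eqI)
    then have "pconst (inverse c) * f = 1" using c by (intro pfun_eqI) simp
    then show ?thesis by (intro bexI[of _ "pconst (inverse c)"]) auto
  qed
  then have "irreducibles_prime (pfuns_on {} :: 'a pfun set)"
    unfolding irreducibles_prime_def irreducible_in_def dvd_in_def by (metis mult.commute)
  then show ?case using noetherian_field[OF is_subring_pfuns_on] inv by blast
next
  case (insert v S)
  note B = is_subring_pfuns_on[of S]
  have "noetherian (pfuns_on (insert v S))"
    unfolding pfuns_on_insert using insert noetherian_polys_over[OF B]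
    by (intro noetherian_image is_subring_polys_over[OF B]) auto
  moreover have "irreducibles_prime (pfuns_on (insert v S))"
    unfolding pfuns_on_insert using insert irreducibles_prime_polys_over[OF B]
    by (intro irreducibles_prime_image[OF inj_on_poly_pvar is_subring_polys_over[OF B]]) auto
  ultimately show ?case ..
qed

section \<open>Partial derivatives and composition\<close>

lemma polyfun_has_derivative:
  "f \<in> polyfun_on UNIV \<Longrightarrow>
     \<exists>g\<in>polyfun_on UNIV. \<forall>x. ((\<lambda>t. f (x(v := t))) has_field_derivative g x) (at (x v))"
proof (induction rule: polyfun_on.induct)
  case (const c)
  show ?case by (rule bexI[of _ "\<lambda>x. 0"]) (auto intro: polyfun_on.const)
next
  case (var w)
  show ?case
    by (rule bexI[of _ "\<lambda>x. if w = v then 1 else 0"]) (auto intro: polyfun_on.const)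
next
  case (add f g)
  then obtain f' g' where "f' \<in> polyfun_on UNIV" "g' \<in> polyfun_on UNIV"
    and d: "\<And>x. ((\<lambda>t. f (x(v := t))) has_field_derivative f' x) (at (x v))"
    "\<And>x. ((\<lambda>t. g (x(v := t))) has_field_derivative g' x) (at (x v))" by blast
  then show ?case
    by (intro bexI[of _ "\<lambda>x. f' x + g' x"] allI DERIV_add d polyfun_on.add)
next
  case (mult f g)
  then obtain f' g' where fg: "f' \<in> polyfun_on UNIV" "g' \<in> polyfun_on UNIV"
    and d: "\<And>x. ((\<lambda>t. f (x(v := t))) has_field_derivative f' x) (at (x v))"
    "\<And>x. ((\<lambda>t. g (x(v := t))) has_field_derivative g' x) (at (x v))" by blast
  have "((\<lambda>t. f (x(v := t)) * g (x(v := t))) has_field_derivative f' x * g x + g' x * f x) (at (x v))" for x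
    using DERIV_mult[OF d(1)[of x] d(2)[of x]] by simp
  then show ?case using mult(1,2) fg
    by (intro bexI[of _ "\<lambda>x. f' x * g x + g' x * f x"] allI polyfun_on.add polyfun_on.mult)
qed

text \<open>The derivative is analytic, and \<open>polyfun_has_derivative\<close> ensures that the
  choice finds a polynomial function; the rules for sums and products then follow from uniqueness of
  complex derivatives.\<close>

definition pdiff :: "'v \<Rightarrow> 'v pfun \<Rightarrow> 'v pfun" where
  "pdiff v f = (SOME g. \<forall>x. ((\<lambda>t. pev f (x(v := t))) has_field_derivative pev g x) (at (x v)))"

lemma pdiff_has_derivative:
  "((\<lambda>t. pev f (x(v := t))) has_field_derivative pev (pdiff v f) x) (at (x v))"
proof -
  have "\<exists>g. \<forall>x. ((\<lambda>t. pev f (x(v := t))) has_field_derivative pev g x) (at (x v))"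
    using polyfun_has_derivative[OF pev, of f v] by (metis pev_Abs)
  from someI_ex[OF this] show ?thesis unfolding pdiff_def by blast
qed

lemma pdiff_eqI:
  assumes "\<And>x. ((\<lambda>t. pev f (x(v := t))) has_field_derivative pev g x) (at (x v))"
  shows "pdiff v f = g"
  using DERIV_unique[OF pdiff_has_derivative assms] by (rule pfun_eqI)

lemma pdiff_eq_0: "f \<in> pfuns_on S \<Longrightarrow> v \<notin> S \<Longrightarrow> pdiff v f = 0"
proof (rule pdiff_eqI)
  fix x assume f: "f \<in> pfuns_on S" "v \<notin> S"
  have "(\<lambda>t. pev f (x(v := t))) = (\<lambda>t. pev f x)"
    using f by (intro ext pfuns_on_cong[OF f(1)]) auto
  then show "((\<lambda>t. pev f (x(v := t))) has_field_derivative pev 0 x) (at (x v))" by simp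
qed

lemma pdiff_pconst [simp]: "pdiff v (pconst c) = 0"
  by (rule pdiff_eqI) simp

lemma pdiff_pvar: "pdiff v (pvar w) = (if w = v then 1 else 0)"
  by (rule pdiff_eqI) auto

lemma is_derivation_pdiff: "is_derivation (pdiff v)"
  unfolding is_derivation_def
proof (intro allI conjI; rule pdiff_eqI)
  fix f g x
  show "((\<lambda>t. pev (f + g) (x(v := t))) has_field_derivative pev (pdiff v f + pdiff v g) x) (at (x v))"
    using DERIV_add[OF pdiff_has_derivative[of f x v] pdiff_has_derivative[of g x v]] by simp
  show "((\<lambda>t. pev (f * g) (x(v := t))) has_field_derivative pev (pdiff v f * g + f * pdiff v g) x) (at (x v))"
    using DERIV_mult[OF pdiff_has_derivative[of f x v] pdiff_has_derivative[of g x v]] by (simp add: mult.commute)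
qed

section \<open>Substitution of polynomial and rational maps\<close>

definition pcomp :: "'v pfun \<Rightarrow> ('v \<Rightarrow> 'w pfun) \<Rightarrow> 'w pfun" where
  "pcomp f \<phi> = Abs_pfun (\<lambda>x. pev f (\<lambda>v. pev (\<phi> v) x))"

lemma pev_pcomp [simp]: "pev (pcomp f \<phi>) x = pev f (\<lambda>v. pev (\<phi> v) x)"
proof -
  have "(\<lambda>x. pev f (\<lambda>v. pev (\<phi> v) x)) \<in> polyfun_on UNIV"
    by (induction f rule: pfun_induct) (auto intro: polyfun_on.intros pev)
  then show ?thesis by (simp add: pcomp_def pev_Abs)
qed

lemma pcomp_simps [simp]:
  "pcomp (pconst c) \<phi> = pconst c" "pcomp (pvar v) \<phi> = \<phi> v"
  "pcomp (f + g) \<phi> = pcomp f \<phi> + pcomp g \<phi>" "pcomp (f * g) \<phi> = pcomp f \<phi> * pcomp g \<phi>" "pcomp 0 \<phi> = 0"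
  by (rule pfun_eqI, simp)+

lemma derivation_chain_rule:
  fixes f :: "'v::finite pfun"
  assumes D: "is_derivation D" and c: "\<And>c. D (pconst c) = 0"
  shows "D (pcomp f \<phi>) = (\<Sum>v\<in>UNIV. pcomp (pdiff v f) \<phi> * D (\<phi> v))"
proof (induction f rule: pfun_induct)
  case (const c)
  show ?case using c by simp
next
  case (var w)
  have "(\<Sum>v\<in>UNIV. pcomp (pdiff v (pvar w)) \<phi> * D (\<phi> v)) = (\<Sum>v\<in>UNIV. if w = v then D (\<phi> v) else 0)"
    by (intro sum.cong refl) (auto simp: pdiff_pvar intro!: pfun_eqI)
  then show ?case by simp
next
  case (add f g)
  then show ?case
    by (simp add: is_derivation_add[OF D] is_derivation_add[OF is_derivation_pdiff] sum.distrib distrib_right)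
next
  case (mult f g)
  then show ?case
    by (simp add: is_derivation_mult[OF D] is_derivation_mult[OF is_derivation_pdiff]
        sum_distrib_left sum_distrib_right sum.distrib[symmetric] algebra_simps)
qed

text \<open>Sums and products need a common power of \<open>den\<close>, so the exponent
  \<open>k\<close> depends on \<open>f\<close>. This is how a rational point is substituted into
  polynomial equations.\<close>

lemma pfun_clear_denominators:
  fixes f :: "'v pfun" and num :: "'v \<Rightarrow> 'w pfun" and den :: "'w pfun"
  obtains k g where "\<And>z. pev den z \<noteq> 0 \<Longrightarrow> pev g z = pev den z ^ k * pev f (\<lambda>v. pev (num v) z / pev den z)"
proof -
  have "\<exists>k g. \<forall>z. pev den z \<noteq> 0 \<longrightarrow> pev g z = pev den z ^ k * pev f (\<lambda>v. pev (num v) z / pev den z)"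
  proof (induction f rule: pfun_induct)
    case (const c)
    show ?case by (rule exI[of _ 0], rule exI[of _ "pconst c"]) simp
  next
    case (var v)
    show ?case by (rule exI[of _ 1], rule exI[of _ "num v"]) simp
  next
    case (add f1 f2)
    then obtain k1 g1 k2 g2 where
      "\<forall>z. pev den z \<noteq> 0 \<longrightarrow> pev g1 z = pev den z ^ k1 * pev f1 (\<lambda>v. pev (num v) z / pev den z)"
      "\<forall>z. pev den z \<noteq> 0 \<longrightarrow> pev g2 z = pev den z ^ k2 * pev f2 (\<lambda>v. pev (num v) z / pev den z)" by blast
    then show ?case
      by (intro exI[of _ "k1 + k2"] exI[of _ "den ^ k2 * g1 + den ^ k1 * g2"])
        (simp add: power_add algebra_simps)
  next
    case (mult f1 f2)
    then obtain k1 g1 k2 g2 where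
      "\<forall>z. pev den z \<noteq> 0 \<longrightarrow> pev g1 z = pev den z ^ k1 * pev f1 (\<lambda>v. pev (num v) z / pev den z)"
      "\<forall>z. pev den z \<noteq> 0 \<longrightarrow> pev g2 z = pev den z ^ k2 * pev f2 (\<lambda>v. pev (num v) z / pev den z)" by blast
    then show ?case
      by (intro exI[of _ "k1 + k2"] exI[of _ "g1 * g2"]) (simp add: power_add mult_ac)
  qed
  then show thesis using that by blast
qed

section \<open>Polynomials and polynomial functions\<close>

lemma mpoly_sum_single: "p = (\<Sum>m\<in>Poly_Mapping.keys p. Poly_Mapping.single m (Poly_Mapping.lookup p m))"
  by (rule poly_mapping_eqI)
    (auto simp: lookup_sum lookup_single when_def in_keys_iff)

lemma mon_eval_add: "mon_eval (m + n) x = mon_eval m x * mon_eval n x"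
  by (simp add: mon_eval_def lookup_add power_add prod.distrib)

lemma mp_eval_superset:
  assumes "finite K" "Poly_Mapping.keys p \<subseteq> K"
  shows "mp_eval p x = (\<Sum>m\<in>K. Poly_Mapping.lookup p m * mon_eval m x)"
  unfolding mp_eval_def
  by (rule sum.mono_neutral_left) (use assms in \<open>auto simp: in_keys_iff\<close>)

lemma mp_eval_add: "mp_eval (p + q) x = mp_eval p x + mp_eval q x"
proof -
  let ?K = "Poly_Mapping.keys p \<union> Poly_Mapping.keys q"
  have "Poly_Mapping.keys (p + q) \<subseteq> ?K" by (rule Poly_Mapping.keys_add)
  then show ?thesis
    by (simp add: mp_eval_superset[of ?K] lookup_add distrib_right sum.distrib)
qed

lemma mp_eval_zero [simp]: "mp_eval 0 x = 0"
  by (simp add: mp_eval_def)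

lemma mp_eval_sum: "mp_eval (sum f A) x = (\<Sum>a\<in>A. mp_eval (f a) x)"
  by (induction A rule: infinite_finite_induct) (auto simp: mp_eval_add)

lemma mp_eval_single [simp]: "mp_eval (Poly_Mapping.single m c) x = c * mon_eval m x"
  by (cases "c = 0") (auto simp: mp_eval_def)

lemma mp_eval_mult: "mp_eval (p * q) x = mp_eval p x * mp_eval q x"
proof -
  have "p * q = (\<Sum>m\<in>Poly_Mapping.keys p. \<Sum>n\<in>Poly_Mapping.keys q.
      Poly_Mapping.single (m + n) (Poly_Mapping.lookup p m * Poly_Mapping.lookup q n))"
    by (subst mpoly_sum_single[of p], subst mpoly_sum_single[of q])
      (simp only: sum_product mult_single)
  then have "mp_eval (p * q) x = (\<Sum>m\<in>Poly_Mapping.keys p. \<Sum>n\<in>Poly_Mapping.keys q.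
      (Poly_Mapping.lookup p m * mon_eval m x) * (Poly_Mapping.lookup q n * mon_eval n x))"
    by (simp add: mp_eval_sum mon_eval_add mult_ac)
  then show ?thesis by (simp add: mp_eval_def sum_product)
qed

lemma mp_eval_one [simp]: "mp_eval 1 x = 1"
  unfolding single_one[symmetric] mp_eval_single by (simp add: mon_eval_def)

text \<open>Fixing the variables of \<open>S\<close> turns the sum into a univariate polynomial in
  \<open>x v\<close>, whose coefficients are sums of the same kind over fewer variables.
  Distinctness in \<open>K\<close> is demanded relative to \<open>S\<close> so that it passes to the
  slices with constant exponent of \<open>v\<close>.\<close>

lemma monomials_linearly_independent:
  fixes c :: "('v \<Rightarrow>\<^sub>0 nat) \<Rightarrow> complex"
  assumes "finite S" "finite K"
    "\<And>m m'. m \<in> K \<Longrightarrow> m' \<in> K \<Longrightarrow> (\<And>i. i \<in> S \<Longrightarrow> Poly_Mapping.lookup m i = Poly_Mapping.lookup m' i) \<Longrightarrow> m = m'"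
    "\<And>x. (\<Sum>m\<in>K. c m * (\<Prod>i\<in>S. x i ^ Poly_Mapping.lookup m i)) = 0" "m \<in> K"
  shows "c m = 0"
  using assms
proof (induction S arbitrary: K m)
  case empty
  then have "K = {m}" by blast
  then show ?case using empty(3) by simp
next
  case (insert v S)
  let ?L = "Poly_Mapping.lookup"
  define j where "j = ?L m v"
  have "(\<Sum>n\<in>{n\<in>K. ?L n v = j}. c n * (\<Prod>i\<in>S. x i ^ ?L n i)) = 0" for x
  proof -
    define q where "q = (\<Sum>n\<in>K. monom (c n * (\<Prod>i\<in>S. x i ^ ?L n i)) (?L n v))"
    have "poly q t = 0" for t
    proof -
      have "poly q t = (\<Sum>n\<in>K. c n * (\<Prod>i\<in>insert v S. (x(v := t)) i ^ ?L n i))"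
        unfolding q_def poly_sum poly_monom
      proof (intro sum.cong refl)
        fix n
        have "(\<Prod>i\<in>S. (x(v := t)) i ^ ?L n i) = (\<Prod>i\<in>S. x i ^ ?L n i)"
          using insert(2) by (intro prod.cong) auto
        then show "c n * (\<Prod>i\<in>S. x i ^ ?L n i) * t ^ ?L n v =
            c n * (\<Prod>i\<in>insert v S. (x(v := t)) i ^ ?L n i)" using insert(1,2) by simp
      qed
      then show ?thesis using insert(6) by simp
    qed
    then have "q = 0" using poly_all_0_iff_0 by blast
    then have "coeff q j = 0" by simp
    moreover have "coeff q j = (\<Sum>n\<in>K. if ?L n v = j then c n * (\<Prod>i\<in>S. x i ^ ?L n i) else 0)"
      by (simp add: q_def coeff_sum)
    ultimately show ?thesis using insert(4) by (simp add: sum.inter_filter)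
  qed
  then show ?case
  proof (rule insert(3)[rotated 2])
    fix n n' assume *: "n \<in> {n\<in>K. ?L n v = j}" "n' \<in> {n\<in>K. ?L n v = j}"
      "\<And>i. i \<in> S \<Longrightarrow> ?L n i = ?L n' i"
    show "n = n'" by (rule insert(5)) (use * in auto)
  qed (use insert(4,7) in \<open>auto simp: j_def\<close>)
qed

lemma mp_eval_eq_0_iff: "(\<forall>x. mp_eval p x = 0) \<longleftrightarrow> p = 0"
proof
  assume *: "\<forall>x. mp_eval p x = 0"
  have "Poly_Mapping.lookup p m = 0" if "m \<in> Poly_Mapping.keys p" for m
    by (rule monomials_linearly_independent[of UNIV "Poly_Mapping.keys p"])
      (use * that in \<open>auto simp: mp_eval_def mon_eval_def poly_mapping_eqI\<close>)
  then show "p = 0" by (metis in_keys_iff poly_mapping_eqI lookup_zero)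
qed simp

lemma pev_prod [simp]: "pev (prod f A) x = (\<Prod>a\<in>A. pev (f a) x)"
  by (induction A rule: infinite_finite_induct) auto

definition pfun_of :: "'v::finite mpoly \<Rightarrow> 'v pfun" where
  "pfun_of p = (\<Sum>m\<in>Poly_Mapping.keys p. pconst (Poly_Mapping.lookup p m) *
     (\<Prod>i\<in>UNIV. pvar i ^ Poly_Mapping.lookup m i))"

lemma pev_pfun_of [simp]: "pev (pfun_of p) x = mp_eval p x"
  by (simp add: pfun_of_def mp_eval_def mon_eval_def)

lemma pfun_of_simps: "pfun_of (p + q) = pfun_of p + pfun_of q" "pfun_of (p * q) = pfun_of p * pfun_of q"
  "pfun_of 1 = 1" "pfun_of 0 = 0"
  by (rule pfun_eqI, simp add: mp_eval_add mp_eval_mult)+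

lemma pfun_of_eq_iff: "pfun_of p = pfun_of q \<longleftrightarrow> p = q"
proof
  assume *: "pfun_of p = pfun_of q"
  have "mp_eval (p - q) x = 0" for x
    using mp_eval_add[of "p - q" q x] arg_cong[OF *, of "\<lambda>f. pev f x"] by simp
  then show "p = q" using mp_eval_eq_0_iff[of "p - q"] by simp
qed simp

lemma surj_pfun_of: "\<exists>p. pfun_of p = f"
proof (induction f rule: pfun_induct)
  case (const c)
  have "mp_eval (Poly_Mapping.single 0 c) x = c" for x :: "'a \<Rightarrow> complex" by (simp add: mon_eval_def)
  then show ?case by (intro exI[of _ "Poly_Mapping.single 0 c"] pfun_eqI) simp
next
  case (var v)
  have "mp_eval (Poly_Mapping.single (Poly_Mapping.single v 1) 1) x = x v" for x :: "'a \<Rightarrow> complex"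
  proof -
    have "mon_eval (Poly_Mapping.single v 1) x = (\<Prod>i\<in>UNIV. if i = v then x i else 1)"
      unfolding mon_eval_def by (intro prod.cong) (auto simp: lookup_single)
    then show ?thesis by simp
  qed
  then show ?case by (intro exI[of _ "Poly_Mapping.single (Poly_Mapping.single v 1) 1"] pfun_eqI) simp
next
  case (add f g)
  then show ?case by (metis pfun_of_simps(1))
next
  case (mult f g)
  then show ?case by (metis pfun_of_simps(2))
qed

lemma irreducible_in_pfun_of:
  assumes "irreducible p" shows "irreducible_in UNIV (pfun_of p)"
proof -
  have dvd: "dvd_in UNIV (pfun_of a) 1 \<longleftrightarrow> a dvd 1" for a :: "'a mpoly"
    unfolding dvd_in_def dvd_def by (metis UNIV_I pfun_of_eq_iff pfun_of_simps(2,3) surj_pfun_of)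
  show ?thesis
    unfolding irreducible_in_def
  proof (intro conjI ballI impI)
    fix f g assume fg: "pfun_of p = f * g"
    obtain a b where ab: "pfun_of a = f" "pfun_of b = g" using surj_pfun_of by blast
    then have "p = a * b" using fg by (metis pfun_of_eq_iff pfun_of_simps(2))
    then show "dvd_in UNIV f 1 \<or> dvd_in UNIV g 1"
      using assms dvd ab unfolding irreducible_def by metis
  qed (use assms dvd pfun_of_eq_iff[of p 0] pfun_of_simps(4) in \<open>auto simp: irreducible_def\<close>)
qed

lemma mp_partial_eval_eq_pdiff: "mp_partial_eval p i x = pev (pdiff i (pfun_of p)) x"
proof -
  let ?L = "Poly_Mapping.lookup"
  have "((\<lambda>t. ?L p m * mon_eval m (x(i := t))) has_field_derivative
      ?L p m * of_nat (?L m i) * (\<Prod>j\<in>UNIV. x j ^ (?L m j - (if j = i then 1 else 0)))) (at (x i))" for m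
  proof -
    let ?C = "\<Prod>j\<in>UNIV - {i}. x j ^ ?L m j"
    have "mon_eval m (x(i := t)) = t ^ ?L m i * ?C" for t
      unfolding mon_eval_def by (subst prod.remove[of _ i]) (auto intro!: prod.cong)
    moreover have "(\<Prod>j\<in>UNIV. x j ^ (?L m j - (if j = i then 1 else 0))) = x i ^ (?L m i - 1) * ?C"
      by (subst prod.remove[of _ i]) (auto intro!: prod.cong)
    \<comment> \<open>For exponent 0 the truncated subtraction is harmless, because the factor
      \<open>of_nat (?L m i)\<close> vanishes.\<close>
    moreover have "((\<lambda>t. ?L p m * (t ^ ?L m i * ?C)) has_field_derivative
        ?L p m * (of_nat (?L m i) * x i ^ (?L m i - 1) * ?C)) (at (x i))"
      by (auto intro!: derivative_eq_intros)
    ultimately show ?thesis by (simp add: mult_ac)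
  qed
  then have "((\<lambda>t. mp_eval p (x(i := t))) has_field_derivative mp_partial_eval p i x) (at (x i))"
    unfolding mp_eval_def mp_partial_eval_def by (intro DERIV_sum)
  then show ?thesis using DERIV_unique[OF _ pdiff_has_derivative[of "pfun_of p" x i]] by simp
qed

lemma in_zariski_closure_iff:
  "x \<in> zariski_closure A \<longleftrightarrow> (\<forall>f. (\<forall>a\<in>A. pev f a = 0) \<longrightarrow> pev f x = 0)"
proof -
  have "x \<in> zariski_closure A \<longleftrightarrow> (\<forall>p. (\<forall>a\<in>A. pev (pfun_of p) a = 0) \<longrightarrow> pev (pfun_of p) x = 0)"
    unfolding zariski_closure_def zero_set_def vanishing_ideal_def by auto
  then show ?thesis by (metis surj_pfun_of)
qed

section \<open>The degree in one variable\<close>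

definition mp_poly :: "'v \<Rightarrow> 'v::finite mpoly \<Rightarrow> 'v pfun poly" where
  "mp_poly v p = (\<Sum>m\<in>Poly_Mapping.keys p. monom (pconst (Poly_Mapping.lookup p m) *
     (\<Prod>i\<in>UNIV - {v}. pvar i ^ Poly_Mapping.lookup m i)) (Poly_Mapping.lookup m v))"

lemma mp_poly_in_polys_over: "mp_poly v p \<in> polys_over (pfuns_on (UNIV - {v}))"
proof -
  note B = is_subring_pfuns_on[of "UNIV - {v}"]
  have "(\<Prod>i\<in>A. pvar i ^ Poly_Mapping.lookup m i) \<in> pfuns_on (UNIV - {v})" if "A \<subseteq> UNIV - {v}" for m A
    using that by (induction A rule: infinite_finite_induct)
      (auto intro!: is_subring_one is_subring_mult is_subring_power B pvar_in_pfuns_on)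
  then show ?thesis unfolding mp_poly_def
    by (intro is_subring_sum is_subring_polys_over monom_in_polys_over is_subring_mult B) auto
qed

lemma poly_mp_poly: "poly (mp_poly v p) (pvar v) = pfun_of p"
  unfolding mp_poly_def pfun_of_def poly_sum poly_monom
proof (intro sum.cong refl)
  fix m :: "'a \<Rightarrow>\<^sub>0 nat"
  have "(\<Prod>i\<in>UNIV. pvar i ^ Poly_Mapping.lookup m i) =
      pvar v ^ Poly_Mapping.lookup m v * (\<Prod>i\<in>UNIV - {v}. pvar i ^ Poly_Mapping.lookup m i)"
    by (subst prod.remove[of _ v]) auto
  then show "pconst (Poly_Mapping.lookup p m) * (\<Prod>i\<in>UNIV - {v}. pvar i ^ Poly_Mapping.lookup m i) *
      pvar v ^ Poly_Mapping.lookup m v =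
      pconst (Poly_Mapping.lookup p m) * (\<Prod>i\<in>UNIV. pvar i ^ Poly_Mapping.lookup m i)"
    by (simp add: mult_ac)
qed

text \<open>Monomials with the same exponent of \<open>v\<close> stay distinct when \<open>v\<close>
  is forgotten, so the coefficient at the maximal exponent does not cancel.\<close>

lemma degree_mp_poly: "degree (mp_poly v p) = degree_in v p"
proof (cases "p = 0")
  case True
  then show ?thesis by (simp add: mp_poly_def degree_in_def)
next
  case False
  let ?L = "Poly_Mapping.lookup" and ?K = "Poly_Mapping.keys p"
  let ?d = "degree_in v p"
  have fin: "finite (insert 0 ((\<lambda>m. ?L m v) ` ?K))" by simp
  have le: "?L m v \<le> ?d" if "m \<in> ?K" for m
    unfolding degree_in_def using that by (intro Max_ge[OF fin]) auto
  have "?K \<noteq> {}" using False by simp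
  have "\<exists>m\<in>?K. ?L m v = ?d"
  proof -
    have "?d \<in> insert 0 ((\<lambda>m. ?L m v) ` ?K)" unfolding degree_in_def by (rule Max_in[OF fin]) simp
    then show ?thesis using \<open>?K \<noteq> {}\<close> le by fastforce
  qed
  then obtain m where m: "m \<in> ?K" "?L m v = ?d" by blast
  have co: "coeff (mp_poly v p) j = (\<Sum>n\<in>{n\<in>?K. ?L n v = j}. pconst (?L p n) * (\<Prod>i\<in>UNIV - {v}. pvar i ^ ?L n i))" for j
    unfolding mp_poly_def coeff_sum coeff_monom by (subst sum.inter_filter) auto
  show ?thesis
  proof (rule antisym)
    show "degree (mp_poly v p) \<le> ?d"
    proof (rule degree_le, intro allI impI)
      fix j assume "?d < j"
      then have "{n\<in>?K. ?L n v = j} = {}" using le by fastforce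
      then show "coeff (mp_poly v p) j = 0" by (simp only: co sum.empty)
    qed
    have "coeff (mp_poly v p) ?d \<noteq> 0"
    proof
      assume 0: "coeff (mp_poly v p) ?d = 0"
      have "?L p m = 0"
      proof (rule monomials_linearly_independent[of "UNIV - {v}" "{n\<in>?K. ?L n v = ?d}"])
        fix x show "(\<Sum>n\<in>{n\<in>?K. ?L n v = ?d}. ?L p n * (\<Prod>i\<in>UNIV - {v}. x i ^ ?L n i)) = 0"
          using arg_cong[OF 0, of "\<lambda>f. pev f x"] by (simp add: co)
      next
        fix n n' assume "n \<in> {n\<in>?K. ?L n v = ?d}" "n' \<in> {n\<in>?K. ?L n v = ?d}"
          "\<And>i. i \<in> UNIV - {v} \<Longrightarrow> ?L n i = ?L n' i"
        then show "n = n'" by (intro poly_mapping_eqI) (metis (mono_tags, lifting) DiffI UNIV_I mem_Collect_eq singletonD)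
      qed (use m in auto)
      then show False using m(1) by (simp add: in_keys_iff)
    qed
    then show "?d \<le> degree (mp_poly v p)" by (rule le_degree)
  qed
qed

text \<open>\<open>double_R\<close> is injective on monomials, so no terms merge or cancel.\<close>

lemma degree_in_ED_poly_eps: "degree_in None (ED_poly_eps F) = 2 * degree_in None F"
proof -
  let ?L = "Poly_Mapping.lookup" and ?K = "Poly_Mapping.keys F"
  have L: "?L (double_R m) None = 2 * ?L m None" "?L (double_R m) (Some i) = ?L m (Some i)" for m :: "'a option \<Rightarrow>\<^sub>0 nat" and i
    by (auto simp: double_R_def lookup_add lookup_single)
  have inj: "double_R m = double_R n \<longleftrightarrow> m = n" for m n :: "'a option \<Rightarrow>\<^sub>0 nat"
  proof
    assume e: "double_R m = double_R n"
    have "?L m v = ?L n v" for v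
      using L(1)[of m] L(1)[of n] L(2)[of m "the v"] L(2)[of n "the v"] unfolding e by (cases v) simp_all
    then show "m = n" by (rule poly_mapping_eqI)
  qed simp
  have lk: "?L (ED_poly_eps F) k = (\<Sum>m\<in>?K. if double_R m = k then ?L F m else 0)" for k
    by (simp add: ED_poly_eps_def lookup_sum lookup_single when_def)
  have lk1: "?L (ED_poly_eps F) (double_R m) = ?L F m" if "m \<in> ?K" for m
    unfolding lk inj using that by simp
  have "Poly_Mapping.keys (ED_poly_eps F) = double_R ` ?K"
  proof
    show "Poly_Mapping.keys (ED_poly_eps F) \<subseteq> double_R ` ?K"
    proof
      fix k assume "k \<in> Poly_Mapping.keys (ED_poly_eps F)"
      then have "(\<Sum>m\<in>?K. if double_R m = k then ?L F m else 0) \<noteq> 0" by (simp add: in_keys_iff lk)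
      then obtain m where "m \<in> ?K" "(if double_R m = k then ?L F m else 0) \<noteq> 0"
        by (rule sum.not_neutral_contains_not_neutral)
      then show "k \<in> double_R ` ?K" by (auto split: if_splits)
    qed
    show "double_R ` ?K \<subseteq> Poly_Mapping.keys (ED_poly_eps F)"
      using lk1 by (auto simp: in_keys_iff)
  qed
  then have "degree_in None (ED_poly_eps F) = Max ((\<lambda>d. 2 * d) ` insert 0 ((\<lambda>m. ?L m None) ` ?K))"
    by (simp only: degree_in_def image_insert image_image L mult_0_right)
  also have "\<dots> = 2 * degree_in None F"
    unfolding degree_in_def by (rule mono_Max_commute[symmetric]) (auto simp: mono_def)
  finally show ?thesis .
qed

section \<open>Generic roots of an irreducible polynomial\<close>

text \<open>\<open>g\<close> plays the part of the discriminant, without resultants. A least-degree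
  element \<open>G\<close> of the ideal of \<open>Q\<close> and its derivative divides a constant
  multiple of \<open>Q\<close>, say with cofactor \<open>h\<close>. As \<open>Q\<close> is prime and
  has larger degree than \<open>G\<close>, it divides \<open>h\<close>, which forces
  \<open>G\<close> to be constant; and elements of that ideal vanish wherever \<open>Q\<close> and
  its derivative do.\<close>

lemma irreducible_discriminant:
  fixes F :: "'v::finite mpoly"
  assumes F: "irreducible F" and deg: "degree_in v F > 0"
  obtains g where "g \<in> pfuns_on (UNIV - {v})" "g \<noteq> 0"
    "\<And>z. mp_eval F z = 0 \<Longrightarrow> pev (pdiff v (pfun_of F)) z = 0 \<Longrightarrow> pev g z = 0"
proof -
  let ?B = "pfuns_on (UNIV - {v}) :: 'v pfun set"
  let ?R = "polys_over ?B"
  define Q where "Q = mp_poly v F"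
  note B = is_subring_pfuns_on[of "UNIV - {v}"]
  note R = is_subring_polys_over[OF B]
  have QR: "Q \<in> ?R" unfolding Q_def by (rule mp_poly_in_polys_over)
  have dQ: "degree Q > 0" using deg by (simp add: Q_def degree_mp_poly)
  then have Q0: "Q \<noteq> 0" by auto
  have img: "(\<lambda>q. poly q (pvar v)) ` ?R = UNIV"
    using pfuns_on_insert[of v "UNIV - {v}"] by (simp add: insert_absorb)
  have "irreducible_in ?R Q"
  proof (rule irreducible_in_reflect[of "\<lambda>q. poly q (pvar v)"])
    show "irreducible_in ((\<lambda>q. poly q (pvar v)) ` ?R) (poly Q (pvar v))"
      unfolding img unfolding Q_def poly_mp_poly by (rule irreducible_in_pfun_of[OF F])
  qed (use QR inj_on_poly_pvar[of v "UNIV - {v}"] R in auto)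
  moreover have "irreducibles_prime ?R"
    using irreducibles_prime_polys_over[OF B] noetherian_irreducibles_prime_pfuns_on[of "UNIV - {v}"] by auto
  ultimately have prime: "prime_in ?R Q" unfolding irreducibles_prime_def by blast
  define Q' where "Q' = pderiv Q"
  have Q'R: "Q' \<in> ?R" unfolding Q'_def by (rule pderiv_in_polys_over[OF B QR])
  have cQ': "coeff Q' (degree Q - 1) \<noteq> 0"
  proof -
    have "coeff Q' (degree Q - 1) = of_nat (degree Q) * lead_coeff Q"
      using dQ by (simp add: Q'_def coeff_pderiv)
    moreover have "(of_nat (degree Q) :: 'v pfun) \<noteq> 0"
      using dQ by (metis less_numeral_extra(3) of_nat_eq_0_iff pev_of_nat pev_simps(1))
    ultimately show ?thesis using Q0 by simp
  qed
  then have Q'0: "Q' \<noteq> 0" by auto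
  have dQ': "degree Q' < degree Q"
  proof -
    have "degree Q' \<le> degree Q - 1"
      unfolding Q'_def by (rule degree_le) (auto simp: coeff_pderiv coeff_eq_0)
    then show ?thesis using dQ by linarith
  qed
  define J where "J = ideal_gen ?R {Q, Q'}"
  have J: "is_ideal ?R J" unfolding J_def by (rule is_ideal_ideal_gen[OF R]) (use QR Q'R in auto)
  have QJ: "Q \<in> J" "Q' \<in> J" unfolding J_def by (auto intro: ideal_gen_superset[OF R])
  obtain G where G: "G \<in> J" "G \<noteq> 0" "degree G \<le> degree Q'"
    "\<And>f. f \<in> J \<Longrightarrow> \<exists>c\<in>?B. c \<noteq> 0 \<and> dvd_in ?R G (smult c f)"
    by (rule polys_over_ideal_min[OF B J QJ(2) Q'0]) blast
  have GR: "G \<in> ?R" using is_ideal_subset[OF J G(1)] .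
  obtain c h where c: "c \<in> ?B" "c \<noteq> 0" and h: "h \<in> ?R" "smult c Q = G * h"
    using G(4)[OF QJ(1)] unfolding dvd_in_def by blast
  have "dvd_in ?R Q (G * h)"
    unfolding dvd_in_def using h(2) const_in_polys_over[OF B c(1)] by (intro bexI[of _ "[:c:]"]) simp
  then consider "dvd_in ?R Q G" | "dvd_in ?R Q h" using prime GR h(1) unfolding prime_in_def by blast
  then have "degree G = 0"
  proof cases
    case 1
    then obtain k where "G = Q * k" unfolding dvd_in_def by blast
    then have "degree Q \<le> degree G" using G(2) by (metis degree_mult_right_le mult_eq_0_iff)
    then show ?thesis using G(3) dQ' by linarith
  next
    case 2
    then obtain k where "h = Q * k" unfolding dvd_in_def by blast
    then have "Q * [:c:] = Q * (G * k)" using h(2) by (simp add: mult_ac)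
    then have "[:c:] = G * k" using Q0 by (metis mult_left_cancel)
    then have "degree G + degree k = 0"
      using c(2) by (metis degree_mult_eq degree_pCons_0 mult_eq_0_iff pCons_eq_0_iff)
    then show ?thesis by simp
  qed
  then obtain g where g: "G = [:g:]" by (metis degree_eq_zeroE)
  have pd: "pdiff v (pfun_of F) = poly Q' (pvar v)"
    unfolding poly_mp_poly[of v F, symmetric] Q'_def Q_def[symmetric]
    by (rule is_derivation_poly[OF is_derivation_pdiff])
      (use polys_overD[OF QR] pdiff_eq_0[of _ "UNIV - {v}" v] pdiff_pvar[of v v] in auto)
  show thesis
  proof (rule that)
    show "g \<in> ?B" using polys_overD[OF GR, of 0] g by simp
    show "g \<noteq> 0" using G(2) g by simp
    fix z assume z: "mp_eval F z = 0" "pev (pdiff v (pfun_of F)) z = 0"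
    have Qz: "pev (poly Q (pvar v)) z = 0" using z(1) unfolding Q_def poly_mp_poly by simp
    have "pev (poly r (pvar v)) z = 0" if "r \<in> J" for r
      using that unfolding J_def
      by (induction rule: ideal_gen.induct) (use Qz z(2) in \<open>auto simp: pd\<close>)
    from this[OF G(1)] show "pev g z = 0" using g by simp
  qed
qed

lemma card_roots_simple:
  fixes p :: "complex poly"
  assumes "p \<noteq> 0" "\<And>a. poly p a = 0 \<Longrightarrow> poly (pderiv p) a \<noteq> 0"
  shows "card {a. poly p a = 0} = degree p"
proof -
  have "rsquarefree p" using assms(2) rsquarefree_roots by blast
  then have "order a p = 0 \<or> order a p = 1" for a by (simp add: rsquarefree_def)
  then have "order a p = 1" if "poly p a = 0" for a using that assms(1) order_root by blast
  then have "size (proots p) = (\<Sum>a\<in>{a. poly p a = 0}. 1)"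
    unfolding size_multiset_overloaded_eq using assms(1) by (intro sum.cong) auto
  then show ?thesis by (simp add: size_proots_complex)
qed

lemma card_generic_roots:
  fixes F :: "'v::finite mpoly"
  assumes F: "irreducible F" and deg: "degree_in v F > 0"
  obtains \<delta> where "\<delta> \<in> pfuns_on (UNIV - {v})" "\<delta> \<noteq> 0"
    "\<And>z. pev \<delta> z \<noteq> 0 \<Longrightarrow> mp_eval F z = 0 \<Longrightarrow> pev (pdiff v (pfun_of F)) z \<noteq> 0"
    "\<And>z. pev \<delta> z \<noteq> 0 \<Longrightarrow> card {r. mp_eval F (z(v := r)) = 0} = degree_in v F"
proof -
  obtain g where g: "g \<in> pfuns_on (UNIV - {v})" "g \<noteq> 0"
    "\<And>z. mp_eval F z = 0 \<Longrightarrow> pev (pdiff v (pfun_of F)) z = 0 \<Longrightarrow> pev g z = 0"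
    using irreducible_discriminant[OF assms] by blast
  define Q where "Q = mp_poly v F"
  note B = is_subring_pfuns_on[of "UNIV - {v}"]
  have QR: "Q \<in> polys_over (pfuns_on (UNIV - {v}))" unfolding Q_def by (rule mp_poly_in_polys_over)
  have dQ: "degree Q = degree_in v F" by (simp add: Q_def degree_mp_poly)
  then have Q0: "Q \<noteq> 0" using deg by auto
  \<comment> \<open>\<open>g\<close> makes the roots of the specialized polynomial simple and the
    leading coefficient keeps its degree; hence their product as \<open>\<delta>\<close>.\<close>
  have card: "card {r. mp_eval F (z(v := r)) = 0} = degree_in v F" if z: "pev (g * lead_coeff Q) z \<noteq> 0" for z
  proof -
    let ?q = "pspec Q z"
    have "coeff ?q (degree Q) \<noteq> 0" using z by simp
    moreover have "degree ?q \<le> degree Q" by (rule degree_le) (auto simp: coeff_eq_0)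
    ultimately have d: "degree ?q = degree Q" "?q \<noteq> 0" by (metis antisym le_degree, metis coeff_0)
    have ev: "poly ?q r = mp_eval F (z(v := r))" for r
      using poly_pspec_upd[OF QR, of v z r] by (simp add: Q_def poly_mp_poly)
    have ev': "poly (pderiv ?q) r = pev (pdiff v (pfun_of F)) (z(v := r))" for r
    proof -
      have "(poly ?q has_field_derivative pev (pdiff v (pfun_of F)) (z(v := r))) (at r)"
        using pdiff_has_derivative[of "pfun_of F" "z(v := r)" v] by (simp add: ev[symmetric])
      then show ?thesis using poly_DERIV DERIV_unique by blast
    qed
    have "poly (pderiv ?q) r \<noteq> 0" if "poly ?q r = 0" for r
    proof
      assume "poly (pderiv ?q) r = 0"
      then have "pev g (z(v := r)) = 0" using g(3) that ev ev' by metis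
      moreover have "pev g (z(v := r)) = pev g z" by (rule pfuns_on_cong[OF g(1)]) auto
      ultimately show False using z by simp
    qed
    then have "card {r. poly ?q r = 0} = degree ?q" using card_roots_simple[OF d(2)] by blast
    then show ?thesis using d dQ by (simp add: ev)
  qed
  show thesis
  proof (rule that[of "g * lead_coeff Q"])
    show "g * lead_coeff Q \<in> pfuns_on (UNIV - {v})"
      by (rule is_subring_mult[OF B g(1) polys_overD[OF QR]])
    show "g * lead_coeff Q \<noteq> 0" using g(2) Q0 by simp
  qed (use g(3) card in auto)
qed

section \<open>Derivations preserving a prime ideal\<close>

text \<open>The variables in \<open>S\<close> are independent modulo \<open>P\<close>, so on
  functions of these alone the partial derivative by \<open>i\<close> trivially respects
  \<open>P\<close>. The other variables are adjoined one at a time by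
  \<open>derivation_extend\<close>; each time the values on \<open>S\<close> are multiplied by some
  \<open>s\<close> outside \<open>P\<close>, so \<open>D (pvar i)\<close> stays outside the prime
  \<open>P\<close>.\<close>

lemma derivation_preserving_prime:
  fixes P :: "'v::finite pfun set"
  assumes P: "is_prime_ideal P" and triv: "P \<inter> pfuns_on S \<subseteq> {0}" and i: "i \<in> S"
  obtains D where "is_derivation D" "\<And>c. D (pconst c) = 0" "\<And>w. w \<in> S \<Longrightarrow> w \<noteq> i \<Longrightarrow> D (pvar w) = 0"
    "D (pvar i) \<notin> P" "\<And>h. h \<in> P \<Longrightarrow> D h \<in> P"
proof -
  have PI: "is_ideal UNIV P" and prime: "\<And>a b. a * b \<in> P \<Longrightarrow> a \<in> P \<or> b \<in> P" and one: "1 \<notin> P"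
    using P is_ideal_mult[of UNIV P _ 1] unfolding is_prime_ideal_def by auto
  have char: "a \<in> P" if "of_nat (Suc n) * a \<in> P" for n and a :: "'v pfun"
  proof -
    have "pconst (1 / of_nat (Suc n)) * (of_nat (Suc n) * a) = a"
      by (rule pfun_eqI) (simp del: of_nat_Suc)
    then show ?thesis using is_ideal_mult[OF PI UNIV_I that] by metis
  qed
  have "\<exists>D. is_derivation D \<and> (\<forall>c. D (pconst c) = 0) \<and> (\<forall>w\<in>S. w \<noteq> i \<longrightarrow> D (pvar w) = 0) \<and>
      D (pvar i) \<notin> P \<and> (\<forall>h\<in>P \<inter> pfuns_on (S \<union> T). D h \<in> P)" if "finite T" "T \<inter> S = {}" for T
    using that
  proof (induction T)
    case empty
    have "pdiff i h \<in> P" if "h \<in> P \<inter> pfuns_on S" for h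
    proof -
      have "h = 0" using that triv by auto
      then show ?thesis using is_derivation_zero[OF is_derivation_pdiff[of i]] is_ideal_zero[OF PI] by simp
    qed
    then show ?case
      by (intro exI[of _ "pdiff i"]) (auto simp: is_derivation_pdiff pdiff_pvar one)
  next
    case (insert v T)
    then obtain D where D: "is_derivation D" "\<forall>c. D (pconst c) = 0" "\<forall>w\<in>S. w \<noteq> i \<longrightarrow> D (pvar w) = 0"
      "D (pvar i) \<notin> P" "\<forall>h\<in>P \<inter> pfuns_on (S \<union> T). D h \<in> P" by auto
    have v: "v \<notin> S \<union> T" using insert by auto
    obtain s t where st: "s \<notin> P" "\<And>q. q \<in> polys_over (pfuns_on (S \<union> T)) \<Longrightarrow> poly q (pvar v) \<in> P \<Longrightarrow>
        s * D (poly q (pvar v)) + t * pdiff v (poly q (pvar v)) \<in> P"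
      by (rule derivation_extend[OF P char is_subring_pfuns_on[of "S \<union> T"] D(1) is_derivation_pdiff[of v], where x = "pvar v"])
        (use D(5) pdiff_eq_0[OF _ v] pdiff_pvar[of v v] in auto)
    define D' where "D' h = s * D h + t * pdiff v h" for h
    have "is_derivation D'"
      unfolding is_derivation_def D'_def
      by (auto simp: is_derivation_add[OF D(1)] is_derivation_mult[OF D(1)]
          is_derivation_add[OF is_derivation_pdiff] is_derivation_mult[OF is_derivation_pdiff] algebra_simps)
    moreover have "D' (pvar w) = s * D (pvar w)" if "w \<in> S" for w
      using that v by (auto simp: D'_def pdiff_pvar)
    moreover have "D' h \<in> P" if "h \<in> P \<inter> pfuns_on (S \<union> insert v T)" for h
      using that st(2) pfuns_on_insert[of v "S \<union> T"] by (auto simp: D'_def)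
    moreover have "D' (pconst c) = 0" for c using D(2) by (simp add: D'_def)
    ultimately show ?case using D(3,4) st(1) prime[of s "D (pvar i)"] i by (intro exI[of _ D']) auto
  qed
  from this[of "- S"] obtain D where D: "is_derivation D" "\<forall>c. D (pconst c) = 0"
    "\<forall>w\<in>S. w \<noteq> i \<longrightarrow> D (pvar w) = 0" "D (pvar i) \<notin> P" "\<forall>h\<in>P. D h \<in> P" by auto
  then show thesis using that by blast
qed

section \<open>The gradient equation on the ED correspondence\<close>

lemma is_derivation_sum: "is_derivation D \<Longrightarrow> D (sum f A) = (\<Sum>a\<in>A. D (f a))"
  by (induction A rule: infinite_finite_induct) (auto simp: is_derivation_zero is_derivation_add)

text \<open>The coefficients of the combination are constants, so a combination of gradients at
  \<open>y\<close> is the gradient of a single function vanishing on \<open>X\<close>.\<close>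

lemma normal_space_gradient:
  assumes "n \<in> normal_space X y"
  obtains h where "\<And>x. x \<in> X \<Longrightarrow> pev h x = 0" "\<And>i. n i = pev (pdiff i h) y"
proof -
  obtain A c where A: "finite A" "A \<subseteq> {mp_grad p y |p. p \<in> vanishing_ideal X}" "n = (\<lambda>i. \<Sum>g\<in>A. c g * g i)"
    using assms unfolding normal_space_def cspan_def by blast
  have "\<forall>g\<in>A. \<exists>p. g = mp_grad p y \<and> p \<in> vanishing_ideal X" using A(2) by blast
  then obtain P where P: "\<And>g. g \<in> A \<Longrightarrow> g = mp_grad (P g) y \<and> P g \<in> vanishing_ideal X" by metis
  define h where "h = (\<Sum>g\<in>A. pconst (c g) * pfun_of (P g))"
  show thesis
  proof (rule that[of h])
    fix x assume "x \<in> X"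
    then show "pev h x = 0" using P by (auto simp: h_def vanishing_ideal_def intro!: sum.neutral)
  next
    fix i
    have "g i = pev (pdiff i (pfun_of (P g))) y" if "g \<in> A" for g
      using P[OF that] by (metis mp_grad_def mp_partial_eval_eq_pdiff)
    then show "n i = pev (pdiff i h) y"
      unfolding A(3) h_def by (simp add: is_derivation_sum[OF is_derivation_pdiff] is_derivation_mult[OF is_derivation_pdiff])
  qed
qed

text \<open>The set whose Zariski closure is \<open>ED_corr\<close>. Derivations are evaluated here,
  where \<open>u - x\<close> is normal by definition.\<close>

definition ED_regular :: "('n::finite \<Rightarrow> complex) set \<Rightarrow> ('n + 'n \<Rightarrow> complex) set" where
  "ED_regular X = {pair_pt y w | y w. y \<in> smooth_locus X \<and> (\<lambda>i. w i - y i) \<in> normal_space X y}"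

text \<open>The map \<open>(x, u) \<mapsto> (u, d_u(x))\<close> by coordinates, with
  \<open>x\<close> under \<open>Inl\<close> and \<open>u\<close> under \<open>Inr\<close>;
  \<open>pcomp f dist_map\<close> pulls \<open>f\<close> back to pairs.\<close>

definition dist_map :: "'n::finite option \<Rightarrow> ('n + 'n) pfun" where
  "dist_map v = (case v of Some i \<Rightarrow> pvar (Inr i)
     | None \<Rightarrow> \<Sum>i\<in>UNIV. (pvar (Inr i) - pvar (Inl i)) * (pvar (Inr i) - pvar (Inl i)))"

text \<open>If it vanishes at a pair for all \<open>i\<close>, then \<open>x\<close> is determined
  by \<open>u\<close> and the squared distance, as long as the derivative of \<open>f\<close> by
  \<open>None\<close> is nonzero there.\<close>

definition grad_eq :: "'n::finite option pfun \<Rightarrow> 'n \<Rightarrow> ('n + 'n) pfun" where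
  "grad_eq f i = pcomp (pdiff (Some i) f) dist_map +
     2 * (pvar (Inr i) - pvar (Inl i)) * pcomp (pdiff None f) dist_map"

lemma pair_pt_simps [simp]: "pair_pt x u (Inl i) = x i" "pair_pt x u (Inr i) = u i"
  by (auto simp: pair_pt_def)

lemma pev_dist_map: "(\<lambda>v. pev (dist_map v) (pair_pt x u)) = uR_pt u (sqdist u x)"
  by (auto simp: fun_eq_iff dist_map_def uR_pt_def sqdist_def split: option.split)

lemma pev_grad_eq:
  "pev (grad_eq f i) (pair_pt x u) = pev (pdiff (Some i) f) (uR_pt u (sqdist u x)) +
     2 * (u i - x i) * pev (pdiff None f) (uR_pt u (sqdist u x))"
  by (simp add: grad_eq_def pev_dist_map)

definition vanishing :: "('v \<Rightarrow> complex) set \<Rightarrow> 'v pfun set" where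
  "vanishing E = {f. \<forall>e\<in>E. pev f e = 0}"

lemma is_ideal_vanishing: "is_ideal UNIV (vanishing E)"
  by (auto simp: is_ideal_def vanishing_def)

text \<open>A derivation \<open>D\<close> preserving the ideal of \<open>E\<close> with \<open>D u\<^sub>j = 0\<close> for \<open>j \<noteq> i\<close> acts on the squared distance
  by \<open>D R = 2 (u\<^sub>i - x\<^sub>i) D u\<^sub>i\<close>, since \<open>u - x\<close> is normal to \<open>X\<close> and \<open>D x\<close> is tangent.\<close>

lemma grad_eq_vanishing:
  fixes f :: "'n::finite option pfun"
  assumes E: "E \<subseteq> ED_regular X" and f: "pcomp f dist_map \<in> vanishing E"
    and P: "is_prime_ideal (vanishing E)" and triv: "vanishing E \<inter> pfuns_on (range Inr) \<subseteq> {0}"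
  shows "grad_eq f i \<in> vanishing E"
proof -
  obtain D where D: "is_derivation D" and Dc: "\<And>c. D (pconst c) = 0"
    and Du: "\<And>w. w \<in> range Inr \<Longrightarrow> w \<noteq> Inr i \<Longrightarrow> D (pvar w) = 0"
    and Di: "D (pvar (Inr i)) \<notin> vanishing E" and DP: "\<And>h. h \<in> vanishing E \<Longrightarrow> D h \<in> vanishing E"
    using derivation_preserving_prime[OF P triv, of "Inr i"] by blast
  have "pev (D (pvar (Inr i)) * grad_eq f i) e = 0" if e: "e \<in> E" for e
  proof -
    obtain y w where yw: "e = pair_pt y w" "y \<in> smooth_locus X" "(\<lambda>i. w i - y i) \<in> normal_space X y"
      using e E unfolding ED_regular_def by blast
    obtain h where hX: "\<And>x. x \<in> X \<Longrightarrow> pev h x = 0" and h: "\<And>j. w j - y j = pev (pdiff j h) y"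
      using normal_space_gradient[OF yw(3)] by metis
    define s where "s = pev (D (pvar (Inr i))) e"
    define a where "a j = pev (D (pvar (Inl j))) e" for j
    have b: "pev (D (pvar (Inr j))) e = (if j = i then s else 0)" for j
      using Du[of "Inr j"] by (auto simp: s_def)
    \<comment> \<open>Read in the \<open>x\<close>-coordinates, a function vanishing on
      \<open>X\<close> vanishes on \<open>E\<close>, so \<open>D\<close> maps it into the ideal. By
      the chain rule \<open>D x\<close> at \<open>e\<close> is then orthogonal to the gradient of
      \<open>h\<close>, which is \<open>w - y\<close>.\<close>
    have "pcomp h (\<lambda>j. pvar (Inl j)) \<in> vanishing E"
      unfolding vanishing_def
    proof (intro CollectI ballI)
      fix e' assume "e' \<in> E"
      then obtain y' w' where "e' = pair_pt y' w'" "y' \<in> smooth_locus X" using E unfolding ED_regular_def by blast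
      then show "pev (pcomp h (\<lambda>j. pvar (Inl j))) e' = 0" using hX by (simp add: smooth_locus_def)
    qed
    then have "D (pcomp h (\<lambda>j. pvar (Inl j))) \<in> vanishing E" by (rule DP)
    then have "pev (D (pcomp h (\<lambda>j. pvar (Inl j)))) e = 0" using e by (simp add: vanishing_def)
    then have tangent: "(\<Sum>j\<in>UNIV. (w j - y j) * a j) = 0"
      by (simp add: derivation_chain_rule[OF D Dc] yw(1) h a_def)
    have "pev (D (dist_map None)) e = (\<Sum>j\<in>UNIV. 2 * (w j - y j) * ((if j = i then s else 0) - a j))"
      by (simp add: dist_map_def is_derivation_sum[OF D] is_derivation_mult[OF D] is_derivation_diff[OF D]
          b a_def[symmetric] yw(1)[symmetric]) (simp add: yw(1) algebra_simps)
    also have "\<dots> = 2 * (\<Sum>j\<in>UNIV. if j = i then (w j - y j) * s else 0) - 2 * (\<Sum>j\<in>UNIV. (w j - y j) * a j)"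
      unfolding sum_distrib_left sum_subtractf[symmetric] by (intro sum.cong) (auto simp: algebra_simps)
    also have "\<dots> = 2 * (w i - y i) * s" using tangent by simp
    finally have DR: "pev (D (dist_map None)) e = 2 * (w i - y i) * s" .
    have DS: "pev (D (dist_map (Some j))) e = (if j = i then s else 0)" for j
      using b by (simp add: dist_map_def)
    have "pev (D (pcomp f dist_map)) e = 0" using DP[OF f] e by (simp add: vanishing_def)
    then have "0 = (\<Sum>v\<in>UNIV. pev (pcomp (pdiff v f) dist_map) e * pev (D (dist_map v)) e)"
      unfolding derivation_chain_rule[OF D Dc] by simp
    also have "\<dots> = pev (pcomp (pdiff None f) dist_map) e * pev (D (dist_map None)) e +
        (\<Sum>j\<in>UNIV. pev (pcomp (pdiff (Some j) f) dist_map) e * pev (D (dist_map (Some j))) e)"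
      by (simp only: UNIV_option_conv) (simp add: sum.reindex)
    also have "(\<Sum>j\<in>UNIV. pev (pcomp (pdiff (Some j) f) dist_map) e * pev (D (dist_map (Some j))) e) =
        (\<Sum>j\<in>UNIV. if j = i then pev (pcomp (pdiff (Some j) f) dist_map) e * s else 0)"
      unfolding DS by (intro sum.cong) auto
    finally have "0 = pev (pcomp (pdiff None f) dist_map) e * (2 * (w i - y i) * s) +
        pev (pcomp (pdiff (Some i) f) dist_map) e * s" unfolding DR by (simp del: pev_pcomp)
    moreover have "pev (D (pvar (Inr i)) * grad_eq f i) e = s * (pev (pcomp (pdiff (Some i) f) dist_map) e +
        2 * (w i - y i) * pev (pcomp (pdiff None f) dist_map) e)"
      by (simp add: grad_eq_def s_def yw(1))
    ultimately show ?thesis by algebra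
  qed
  \<comment> \<open>Only this product is known to vanish; its first factor lies outside the ideal,
    and primality removes it.\<close>
  then have "D (pvar (Inr i)) * grad_eq f i \<in> vanishing E" by (simp add: vanishing_def)
  then show ?thesis using P Di unfolding is_prime_ideal_def by blast
qed

text \<open>\<open>\<Delta>\<close> discards the pieces that do not dominate \<open>u\<close>-space:
  if the ideal of \<open>E\<close> contains a nonzero function of \<open>u\<close> alone, that
  function serves. If the ideal is not prime, a product \<open>a * b\<close> in it covers
  \<open>E\<close> by the parts where \<open>a\<close> or \<open>b\<close> vanishes; their ideals
  are strictly larger, and the two factors obtained there are multiplied.\<close>

lemma generic_grad_eq:
  fixes f :: "'n::finite option pfun"
  assumes f: "pcomp f dist_map \<in> vanishing (ED_regular X)"
  obtains \<Delta> where "\<Delta> \<noteq> 0" "\<And>i. pcomp \<Delta> (\<lambda>j. pvar (Inr j)) * grad_eq f i \<in> vanishing (ED_regular X)"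
proof -
  let ?up = "\<lambda>\<Delta>. pcomp \<Delta> (\<lambda>j. pvar (Inr j)) :: ('n + 'n) pfun"
  have noeth: "noetherian (UNIV :: ('n + 'n) pfun set)"
    using noetherian_irreducibles_prime_pfuns_on[of "UNIV :: ('n + 'n) set"] by simp
  have sub: "is_subring (UNIV :: ('n + 'n) pfun set)" by (simp add: is_subring_def)
  have one: "(1 :: 'n pfun) \<noteq> 0" by simp
  have "\<forall>E. I = vanishing E \<longrightarrow> E \<subseteq> ED_regular X \<longrightarrow> (\<exists>\<Delta>. \<Delta> \<noteq> 0 \<and> (\<forall>i. ?up \<Delta> * grad_eq f i \<in> vanishing E))" for I
  proof (induction I rule: wf_induct_rule[OF noetherian_wf[OF sub noeth]])
    case (1 I)
    show ?case
    proof (intro allI impI)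
      fix E assume I: "I = vanishing E" and E: "E \<subseteq> ED_regular X"
      consider (empty) "vanishing E = UNIV" | (prime) "is_prime_ideal (vanishing E)"
        | (red) a b where "a * b \<in> vanishing E" "a \<notin> vanishing E" "b \<notin> vanishing E"
        using is_ideal_vanishing[of E] unfolding is_prime_ideal_def by blast
      then show "\<exists>\<Delta>. \<Delta> \<noteq> 0 \<and> (\<forall>i. ?up \<Delta> * grad_eq f i \<in> vanishing E)"
      proof cases
        case empty
        then show ?thesis using one by blast
      next
        case prime
        have fE: "pcomp f dist_map \<in> vanishing E" using f E by (auto simp: vanishing_def)
        show ?thesis
        proof (cases "vanishing E \<inter> pfuns_on (range Inr) \<subseteq> {0}")
          case True
          have "grad_eq f i \<in> vanishing E" for i by (rule grad_eq_vanishing[OF E fE prime True])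
          then have "?up 1 * grad_eq f i \<in> vanishing E" for i by (simp add: vanishing_def)
          then show ?thesis using one by blast
        next
          case False
          then obtain d where d: "d \<in> vanishing E" "d \<in> pfuns_on (range Inr)" "d \<noteq> 0" by blast
          \<comment> \<open>\<open>d\<close> involves only the \<open>u\<close>-coordinates, so
            setting the \<open>x\<close>-coordinates to 0 loses nothing.\<close>
          define \<Delta> where "\<Delta> = pcomp d (case_sum (\<lambda>j. 0) pvar)"
          have up: "?up \<Delta> = d"
          proof (rule pfun_eqI)
            fix e
            show "pev (?up \<Delta>) e = pev d e"
              unfolding \<Delta>_def pev_pcomp by (rule pfuns_on_cong[OF d(2)]) auto
          qed
          then have "\<Delta> \<noteq> 0" using d(3) by auto
          moreover have "?up \<Delta> * grad_eq f i \<in> vanishing E" for i using d(1) by (simp add: up vanishing_def)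
          ultimately show ?thesis by blast
        qed
      next
        case red
        have sm: "\<exists>\<Delta>. \<Delta> \<noteq> 0 \<and> (\<forall>i. ?up \<Delta> * grad_eq f i \<in> vanishing {e\<in>E. pev c e = 0})"
          if "c \<notin> vanishing E" for c
        proof (rule 1[rule_format, OF _ refl])
          have "vanishing E \<subseteq> vanishing {e\<in>E. pev c e = 0}" "c \<in> vanishing {e\<in>E. pev c e = 0}"
            by (auto simp: vanishing_def)
          then show "(vanishing {e\<in>E. pev c e = 0}, I) \<in> {(J, I). is_ideal UNIV I \<and> is_ideal UNIV J \<and> I \<subset> J}"
            using that is_ideal_vanishing unfolding I by blast
        qed (use E in auto)
        obtain \<Delta>1 \<Delta>2 where \<Delta>: "\<Delta>1 \<noteq> 0" "\<Delta>2 \<noteq> 0"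
          and v: "\<And>i. ?up \<Delta>1 * grad_eq f i \<in> vanishing {e\<in>E. pev a e = 0}"
          "\<And>i. ?up \<Delta>2 * grad_eq f i \<in> vanishing {e\<in>E. pev b e = 0}"
          using sm[OF red(2)] sm[OF red(3)] by blast
        have "?up (\<Delta>1 * \<Delta>2) * grad_eq f i \<in> vanishing E" for i
          unfolding vanishing_def
        proof (intro CollectI ballI)
          fix e assume e: "e \<in> E"
          then have "pev a e = 0 \<or> pev b e = 0" using red(1) by (auto simp: vanishing_def)
          then have "pev (?up \<Delta>1 * grad_eq f i) e = 0 \<or> pev (?up \<Delta>2 * grad_eq f i) e = 0"
            using v[of i] e by (auto simp: vanishing_def)
          then show "pev (?up (\<Delta>1 * \<Delta>2) * grad_eq f i) e = 0" by auto
        qed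
        then show ?thesis using \<Delta> by (intro exI[of _ "\<Delta>1 * \<Delta>2"]) auto
      qed
    qed
  qed
  then show thesis using that by blast
qed

section \<open>Generic fibers and the ED polynomial\<close>

lemma uR_pt_simps [simp]: "uR_pt u r (Some i) = u i" "uR_pt u r None = r"
  "(uR_pt u r)(None := r') = uR_pt u r'"
  by (auto simp: uR_pt_def fun_eq_iff split: option.split)

text \<open>The value 0 for \<open>None\<close> is arbitrary: it is used for functions free of
  \<open>None\<close>.\<close>

definition forget_R :: "'n option pfun \<Rightarrow> 'n pfun" where
  "forget_R d = pcomp d (case_option 0 pvar)"

lemma pev_forget_R:
  assumes "d \<in> pfuns_on (UNIV - {None})" shows "pev (forget_R d) u = pev d (uR_pt u r)"
  unfolding forget_R_def pev_pcomp by (rule pfuns_on_cong[OF assms]) (auto split: option.split)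

lemma forget_R_nonzero:
  assumes "d \<in> pfuns_on (UNIV - {None})" "d \<noteq> 0" shows "forget_R d \<noteq> 0"
proof
  assume 0: "forget_R d = 0"
  have "pev d z = 0" for z
  proof -
    have "z = uR_pt (\<lambda>i. z (Some i)) (z None)" by (auto simp: uR_pt_def fun_eq_iff split: option.split)
    then show ?thesis using pev_forget_R[OF assms(1)] 0 by (metis pev_simps(1))
  qed
  then show False using assms(2) by (metis pev_simps(1) pfun_eqI)
qed

lemma algebraic_set_nonzero:
  assumes "algebraic_set Z" "Z \<noteq> UNIV"
  obtains p where "p \<noteq> 0" "\<And>z. z \<in> Z \<Longrightarrow> pev p z = 0"
proof -
  obtain S where S: "Z = zero_set S" using assms(1) unfolding algebraic_set_def by blast
  then obtain z p where "p \<in> S" "mp_eval p z \<noteq> 0" using assms(2) unfolding zero_set_def by blast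
  then show thesis using S that[of "pfun_of p"] by (auto simp: zero_set_def) (metis pev_pfun_of pev_simps(1))
qed

text \<open>Two nonempty Zariski-open sets meet, since a product of nonzero polynomial functions is
  nonzero. This makes the \<open>THE\<close> in \<open>EDdeg\<close> determinate.\<close>

lemma generic_fiber_card_unique:
  assumes "generic_fiber_card X d" "generic_fiber_card X d'" shows "d = d'"
proof -
  obtain Z Z' where Z: "algebraic_set Z" "Z \<noteq> UNIV" "\<forall>u. u \<notin> Z \<longrightarrow> card (ED_fiber X u) = d"
    and Z': "algebraic_set Z'" "Z' \<noteq> UNIV" "\<forall>u. u \<notin> Z' \<longrightarrow> card (ED_fiber X u) = d'"
    using assms unfolding generic_fiber_card_def by blast
  obtain p p' where p: "p \<noteq> 0" "\<And>z. z \<in> Z \<Longrightarrow> pev p z = 0" and p': "p' \<noteq> 0" "\<And>z. z \<in> Z' \<Longrightarrow> pev p' z = 0"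
    using algebraic_set_nonzero[OF Z(1,2)] algebraic_set_nonzero[OF Z'(1,2)] by metis
  have "p * p' \<noteq> 0" using p(1) p'(1) by simp
  then obtain u where "pev (p * p') u \<noteq> 0" by (metis pev_simps(1) pfun_eqI)
  then have "u \<notin> Z" "u \<notin> Z'" using p(2) p'(2) by auto
  then show ?thesis using Z(3) Z'(3) by metis
qed

lemma ED_corr_iff:
  "(x, u) \<in> ED_corr X \<longleftrightarrow> (\<forall>h\<in>vanishing (ED_regular X). pev h (pair_pt x u) = 0)"
  unfolding ED_corr_def ED_regular_def[symmetric] by (auto simp: in_zariski_closure_iff vanishing_def)

text \<open>The second clause is the transfer principle: the zero set of \<open>F\<close> is the
  closure of the image, so identities on the image also hold at roots of \<open>F\<close> not known
  to come from a pair.\<close>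

lemma ED_image_poly:
  assumes F: "is_ED_poly_R X F"
  shows "(x, u) \<in> ED_corr X \<Longrightarrow> mp_eval F (uR_pt u (sqdist u x)) = 0"
    and "\<And>h r. (\<And>x u. (x, u) \<in> ED_corr X \<Longrightarrow> pev h (uR_pt u (sqdist u x)) = 0) \<Longrightarrow>
      mp_eval F (uR_pt u r) = 0 \<Longrightarrow> pev h (uR_pt u r) = 0"
proof -
  have cl: "z \<in> zariski_closure (ED_image X) \<longleftrightarrow> mp_eval F z = 0" for z
    using F unfolding is_ED_poly_R_def by (simp add: zero_set_def)
  show "mp_eval F (uR_pt u (sqdist u x)) = 0" if "(x, u) \<in> ED_corr X"
    unfolding cl[symmetric] in_zariski_closure_iff using that by (auto simp: ED_image_def)
  show "pev h (uR_pt u r) = 0"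
    if "\<And>x u. (x, u) \<in> ED_corr X \<Longrightarrow> pev h (uR_pt u (sqdist u x)) = 0" "mp_eval F (uR_pt u r) = 0" for h r
  proof -
    have "\<forall>a\<in>ED_image X. pev h a = 0" using that(1) by (auto simp: ED_image_def)
    then show ?thesis using that(2) cl[of "uR_pt u r"] unfolding in_zariski_closure_iff by blast
  qed
qed

text \<open>Otherwise \<open>F\<close> is a nonzero function of \<open>u\<close> alone that vanishes
  on the projection of the correspondence, against dominance.\<close>

lemma ED_poly_degree_pos:
  fixes X :: "('n::finite \<Rightarrow> complex) set"
  assumes dom: "ED_dominant X" and F: "is_ED_poly_R X F"
  shows "degree_in None F > 0"
proof (rule ccontr)
  assume "\<not> degree_in None F > 0"
  then have "degree (mp_poly None F) = 0" by (simp add: degree_mp_poly)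
  then obtain g where g: "mp_poly None F = [:g:]" by (metis degree_eq_zeroE)
  then have fg: "pfun_of F = g" using poly_mp_poly[of None F] by simp
  have gB: "g \<in> pfuns_on (UNIV - {None})" using polys_overD[OF mp_poly_in_polys_over[of None F], of 0] g by simp
  have "F \<noteq> 0" using F by (auto simp: is_ED_poly_R_def)
  then have "g \<noteq> 0" using fg pfun_of_eq_iff[of F 0] pfun_of_simps(4) by auto
  then have nz: "forget_R g \<noteq> 0" by (rule forget_R_nonzero[OF gB])
  have "pev (forget_R g) u = 0" if "u \<in> snd ` ED_corr X" for u
  proof -
    obtain x where "(x, u) \<in> ED_corr X" using \<open>u \<in> snd ` ED_corr X\<close> by auto
    then have "pev g (uR_pt u (sqdist u x)) = 0"
      using ED_image_poly(1)[OF F] unfolding fg[symmetric] by simp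
    then show ?thesis using pev_forget_R[OF gB] by metis
  qed
  then have "pev (forget_R g) u = 0" for u
    using dom in_zariski_closure_iff[of u "snd ` ED_corr X"] unfolding ED_dominant_def by auto
  then show False using nz by (metis pev_simps(1) pfun_eqI)
qed

theorem generic_fiber_card_ED_poly:
  fixes X :: "('n::finite \<Rightarrow> complex) set"
  assumes dom: "ED_dominant X" and F: "is_ED_poly_R X F"
  shows "generic_fiber_card X (degree_in None F)"
proof -
  define f where "f = pfun_of F"
  \<comment> \<open>The denominator of the rational inverse: the gradient equation reads
    \<open>s x_i = s u_i + df/du_i\<close>.\<close>
  define s where "s = 2 * pdiff None f"
  have irr: "irreducible F" using F by (simp add: is_ED_poly_R_def)
  have deg: "degree_in None F > 0" by (rule ED_poly_degree_pos[OF assms])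
  obtain \<delta> where \<delta>: "\<delta> \<in> pfuns_on (UNIV - {None})" "\<delta> \<noteq> 0"
    "\<And>z. pev \<delta> z \<noteq> 0 \<Longrightarrow> mp_eval F z = 0 \<Longrightarrow> pev (pdiff None f) z \<noteq> 0"
    "\<And>z. pev \<delta> z \<noteq> 0 \<Longrightarrow> card {r. mp_eval F (z(None := r)) = 0} = degree_in None F"
    using card_generic_roots[OF irr deg] unfolding f_def by blast
  have "pcomp f dist_map \<in> vanishing (ED_regular X)"
    unfolding vanishing_def
  proof (intro CollectI ballI)
    fix e assume e: "e \<in> ED_regular X"
    then obtain y w where yw: "e = pair_pt y w" unfolding ED_regular_def by blast
    have "(y, w) \<in> ED_corr X" unfolding ED_corr_iff using e yw by (auto simp: vanishing_def)
    then show "pev (pcomp f dist_map) e = 0"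
      using ED_image_poly(1)[OF F] by (simp add: yw pev_dist_map f_def)
  qed
  then obtain \<Delta> where \<Delta>: "\<Delta> \<noteq> 0"
    "\<And>i. pcomp \<Delta> (\<lambda>j. pvar (Inr j)) * grad_eq f i \<in> vanishing (ED_regular X)"
    using generic_grad_eq by blast
  have grad: "pev s z * x i = pev s z * u i + pev (pdiff (Some i) f) z"
    if "(x, u) \<in> ED_corr X" "pev \<Delta> u \<noteq> 0" "z = uR_pt u (sqdist u x)" for x u z i
  proof -
    have "pev (pcomp \<Delta> (\<lambda>j. pvar (Inr j)) * grad_eq f i) (pair_pt x u) = 0"
      using that(1) \<Delta>(2) unfolding ED_corr_iff by blast
    then have "pev (pdiff (Some i) f) z + 2 * (u i - x i) * pev (pdiff None f) z = 0"
      using that(2,3) by (simp add: pev_grad_eq)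
    then show ?thesis by (simp add: s_def algebra_simps)
  qed
  \<comment> \<open>Outside the zeros of this product the gradient equation holds over
    \<open>u\<close>, and \<open>F\<close> has its full number of roots there, all simple.\<close>
  obtain p where p: "pfun_of p = \<Delta> * forget_R \<delta>" using surj_pfun_of by blast
  define Z where "Z = zero_set {p}"
  have "algebraic_set Z" unfolding Z_def algebraic_set_def by blast
  moreover have "Z \<noteq> UNIV"
  proof
    assume "Z = UNIV"
    then have "pev (pfun_of p) u = 0" for u by (auto simp: Z_def zero_set_def)
    then have "pfun_of p = 0" by (intro pfun_eqI) simp
    then show False using p \<Delta>(1) forget_R_nonzero[OF \<delta>(1,2)] by simp
  qed
  moreover have "finite (ED_fiber X u) \<and> card (ED_fiber X u) = degree_in None F" if u: "u \<notin> Z" for u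
  proof -
    have "pev (pfun_of p) u \<noteq> 0" using u by (simp add: Z_def zero_set_def)
    then have \<Delta>u: "pev \<Delta> u \<noteq> 0" and \<delta>u: "pev \<delta> (uR_pt u r) \<noteq> 0" for r
      unfolding p using pev_forget_R[OF \<delta>(1), of u r] by auto
    have su: "pev s (uR_pt u r) \<noteq> 0" if "mp_eval F (uR_pt u r) = 0" for r
      using \<delta>(3)[OF \<delta>u that] by (simp add: s_def)
    define roots where "roots = {r. mp_eval F (uR_pt u r) = 0}"
    have card: "card roots = degree_in None F"
      using \<delta>(4)[OF \<delta>u[of 0]] unfolding roots_def by simp
    have "bij_betw (sqdist u) (ED_fiber X u) roots"
      unfolding bij_betw_def
    proof
      show "inj_on (sqdist u) (ED_fiber X u)"
      proof (rule inj_onI, rule ext)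
        fix x y i assume xy: "x \<in> ED_fiber X u" "y \<in> ED_fiber X u" "sqdist u x = sqdist u y"
        let ?z = "uR_pt u (sqdist u x)"
        have x: "(x, u) \<in> ED_corr X" and y: "(y, u) \<in> ED_corr X" using xy by (auto simp: ED_fiber_def)
        have "pev s ?z * x i = pev s ?z * y i"
          using grad[OF x \<Delta>u refl, of i] grad[OF y \<Delta>u, of ?z i] xy(3) by simp
        then show "x i = y i" using su[OF ED_image_poly(1)[OF F x]] by simp
      qed
      show "sqdist u ` ED_fiber X u = roots"
      proof
        show "sqdist u ` ED_fiber X u \<subseteq> roots"
          using ED_image_poly(1)[OF F] by (auto simp: roots_def ED_fiber_def)
        show "roots \<subseteq> sqdist u ` ED_fiber X u"
        proof
          fix r assume "r \<in> roots"
          then have r: "mp_eval F (uR_pt u r) = 0" by (simp add: roots_def)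
          \<comment> \<open>The candidate preimage comes from the solved gradient equation. The
            \<open>u\<close>-coordinates are written as \<open>s u_i / s\<close> so that all
            coordinates share the denominator \<open>s\<close>.\<close>
          define num :: "'n + 'n \<Rightarrow> 'n option pfun" where
            "num = case_sum (\<lambda>i. s * pvar (Some i) + pdiff (Some i) f) (\<lambda>i. s * pvar (Some i))"
          define pt where "pt z = (\<lambda>v. pev (num v) z / pev s z)" for z
          define x where "x i = pt (uR_pt u r) (Inl i)" for i
          define up :: "'n pfun \<Rightarrow> 'n option pfun" where "up d = pcomp d (\<lambda>i. pvar (Some i))" for d
          have up: "pev (up d) (uR_pt u' r') = pev d u'" for d u' r' by (simp add: up_def)
          have pt: "pt (uR_pt u' r') = pair_pt x' u'"
            if "(x', u') \<in> ED_corr X" "pev \<Delta> u' \<noteq> 0" "r' = sqdist u' x'" "pev s (uR_pt u' r') \<noteq> 0" for x' u' r'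
          proof
            fix v show "pt (uR_pt u' r') v = pair_pt x' u' v"
            proof (cases v)
              case (Inl i)
              then show ?thesis using grad[OF that(1,2), of "uR_pt u' r'" i] that(3,4)
                by (simp add: pt_def num_def field_simps)
            next
              case (Inr i)
              then show ?thesis using that(4) by (simp add: pt_def num_def)
            qed
          qed
          have ptu: "pt (uR_pt u r) = pair_pt x u"
          proof
            fix v show "pt (uR_pt u r) v = pair_pt x u v"
              using su[OF r] by (cases v) (auto simp: x_def pt_def num_def)
          qed
          \<comment> \<open>At image points where \<open>\<Delta>\<close> or \<open>s\<close>
            vanishes nothing is known about \<open>h\<close>. Multiplying by both gives a function
            that vanishes on the whole image, hence at the root, where neither factor is
            zero.\<close>
          have transfer: "pev h (uR_pt u r) = 0"
            if h: "\<And>x' u'. (x', u') \<in> ED_corr X \<Longrightarrow> pev \<Delta> u' \<noteq> 0 \<Longrightarrow> pev s (uR_pt u' (sqdist u' x')) \<noteq> 0 \<Longrightarrow>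
              pev h (uR_pt u' (sqdist u' x')) = 0" for h
          proof -
            have "pev (up \<Delta> * s * h) (uR_pt u r) = 0"
              by (rule ED_image_poly(2)[OF F _ r]) (use h up in auto)
            then show ?thesis using \<Delta>u su[OF r] up by simp
          qed
          \<comment> \<open>The correspondence is Zariski closed, so membership amounts to
            polynomial equations; with denominators cleared, each one transfers from the image to
            the root.\<close>
          have "(x, u) \<in> ED_corr X"
            unfolding ED_corr_iff
          proof
            fix h assume h: "h \<in> vanishing (ED_regular X)"
            obtain k g where g: "\<And>z. pev s z \<noteq> 0 \<Longrightarrow> pev g z = pev s z ^ k * pev h (pt z)"
              using pfun_clear_denominators[of s h num] unfolding pt_def by blast
            have "pev g (uR_pt u r) = 0"
              by (rule transfer) (use g pt h in \<open>auto simp: ED_corr_iff\<close>)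
            then show "pev h (pair_pt x u) = 0" using g su[OF r] ptu by simp
          qed
          moreover have "sqdist u x = r"
          proof -
            \<comment> \<open>\<open>h = 0\<close> says that the rational point has squared distance
              \<open>R\<close>: insert \<open>x_i - u_i = (df/du_i) / s\<close> and multiply by
              \<open>s * s\<close>.\<close>
            define h where "h = (\<Sum>i\<in>UNIV. pdiff (Some i) f * pdiff (Some i) f) - s * s * pvar None"
            have sq: "pev s (uR_pt u' r') * pev s (uR_pt u' r') * sqdist u' x' =
                pev (\<Sum>i\<in>UNIV. pdiff (Some i) f * pdiff (Some i) f) (uR_pt u' r')"
              if "\<And>i. pev s (uR_pt u' r') * x' i = pev s (uR_pt u' r') * u' i + pev (pdiff (Some i) f) (uR_pt u' r')"
              for u' r' x'
            proof -
              have "pev s (uR_pt u' r') * pev s (uR_pt u' r') * ((u' i - x' i) * (u' i - x' i)) =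
                  pev (pdiff (Some i) f) (uR_pt u' r') * pev (pdiff (Some i) f) (uR_pt u' r')" for i
                using that[of i] by algebra
              then show ?thesis by (simp add: sqdist_def sum_distrib_left)
            qed
            have "pev h (uR_pt u r) = 0"
              by (rule transfer) (use sq grad in \<open>auto simp: h_def\<close>)
            moreover have "pev s (uR_pt u r) * x i = pev s (uR_pt u r) * u i + pev (pdiff (Some i) f) (uR_pt u r)" for i
              using su[OF r] by (simp add: x_def pt_def num_def)
            ultimately show ?thesis using sq[of u r x] su[OF r] by (simp add: h_def)
          qed
          ultimately show "r \<in> sqdist u ` ED_fiber X u" by (auto simp: ED_fiber_def image_iff)
        qed
      qed
    qed
    \<comment> \<open>\<open>card roots\<close> is positive, which excludes an infinite set of
      roots, whose \<open>card\<close> would be 0.\<close>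
    then show ?thesis
      using card deg by (metis bij_betw_finite bij_betw_same_card card_ge_0_finite)
  qed
  ultimately show ?thesis unfolding generic_fiber_card_def by blast
qed

theorem mainTheorem5:
  fixes X :: "('n::finite \<Rightarrow> complex) set"
    and F :: "'n option mpoly"
  assumes "irreducible_variety X"
    and "EDdeg X > 0"
    and "is_ED_poly_R X F"
  shows "degree_in None (ED_poly_eps F) = 2 * EDdeg X"
proof -
  \<comment> \<open>Positivity excludes the default value 0 of \<open>EDdeg\<close>.\<close>
  have dom: "ED_dominant X" using assms(2) unfolding EDdeg_def by presburger
  note gen = generic_fiber_card_ED_poly[OF dom assms(3)]
  have "EDdeg X = degree_in None F"
    unfolding EDdeg_def using dom the_equality[of "generic_fiber_card X", OF gen]
      generic_fiber_card_unique[OF _ gen] by simp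
  then show ?thesis by (simp add: degree_in_ED_poly_eps)
qed

end
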